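(* There exists an irreducible geodesic net in the Euclidean plane $\mathbb{R}^2$ with exactly 4 boundary vertices and exactly 25 balanced vertices.
   Context: **Geodesic net.** Let $S$ be a finite set of points in the Euclidean plane $\mathbb{R}^2$. Given a connected, finite graph $G=(V,E)$ embedded in $\mathbb{R}^2$ and a subset of vertices $S\subset V$, $G$ is a *geodesic net with boundary vertex set $S$* if (i) every edge in $E$ is a straight line segment; (ii) at each vertex $v\in V\setminus S$ (the *balanced vertices* ) the sum of all unit vectors at $v$ directed along the edges incident to $v$, from $v$ towards the opposite end of each edge, is equal to zero. The vertices in $S$ are called *boundary vertices* (or unbalanced vertices). **Conventions.** Geodesic nets are connected; edges carry no weights or multiplicities (each edge has weight one and edges do not overlap). The net whose balanced vertices are counted is not allowed to have balanced vertices of degree two (such vertices could be added artificially along any segment). **Subnet.** Given two geodesic nets $G'$ and $G$, $G'$ is a *subnet* of $G$ if $G'$ is a subgraph of $G$ and the boundary vertex set of $G'$ is a subset of the boundary vertex set of $G$. (Here $G'$ is any geodesic net in the sense of (i), (ii); in particular a balanced vertex of $G$ may have degree two in $G'$, when $G'$ passes straight through it.) **Irreducible.** A geodesic net $G$ is *irreducible* if for every geodesic net $G'$ that is a subnet of $G$, either $G'=G$ or $G'$ consists of a single point. *)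

theory Defs
  imports "HOL-Analysis.Analysis"
begin

(* Vertices are points of the plane.  As edges are straight and do not overlap, the graph
   is simple and an edge e is determined by its pair of end points; the segment it
   occupies is convex hull e. *)
record plane_net =
  verts :: "(real ^ 2) set"
  edges :: "(real ^ 2) set set"
  bdry :: "(real ^ 2) set"

definition finite_graph :: "plane_net \<Rightarrow> bool" where
  "finite_graph G \<longleftrightarrow> finite (verts G) \<and> (\<forall>e\<in>edges G. e \<subseteq> verts G \<and> card e = 2)"

definition connected_graph :: "plane_net \<Rightarrow> bool" where
  "connected_graph G \<longleftrightarrow> verts G \<noteq> {} \<and>
     (\<forall>u\<in>verts G. \<forall>v\<in>verts G. (u, v) \<in> {(x, y). {x, y} \<in> edges G}\<^sup>*)"

definition embedded_graph :: "plane_net \<Rightarrow> bool" where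
  "embedded_graph G \<longleftrightarrow>
     (\<forall>e\<in>edges G. convex hull e \<inter> verts G = e) \<and>
     (\<forall>e\<in>edges G. \<forall>f\<in>edges G. e \<noteq> f \<longrightarrow> convex hull e \<inter> convex hull f = e \<inter> f)"

definition neighbours :: "plane_net \<Rightarrow> real ^ 2 \<Rightarrow> (real ^ 2) set" where
  "neighbours G v = {w. {v, w} \<in> edges G}"

(* sgn x is the unit vector x /\<^sub>R norm x. *)
definition balanced_at :: "plane_net \<Rightarrow> real ^ 2 \<Rightarrow> bool" where
  "balanced_at G v \<longleftrightarrow> (\<Sum>w\<in>neighbours G v. sgn (w - v)) = 0"

definition balanced_verts :: "plane_net \<Rightarrow> (real ^ 2) set" where
  "balanced_verts G = verts G - bdry G"

definition geodesic_net :: "plane_net \<Rightarrow> bool" where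
  "geodesic_net G \<longleftrightarrow>
     finite_graph G \<and> connected_graph G \<and> embedded_graph G \<and> bdry G \<subseteq> verts G \<and>
     (\<forall>v\<in>balanced_verts G. balanced_at G v)"

(* Not part of geodesic_net: a balanced vertex of a net may have degree two in a subnet. *)
definition no_degree_two :: "plane_net \<Rightarrow> bool" where
  "no_degree_two G \<longleftrightarrow> (\<forall>v\<in>balanced_verts G. card (neighbours G v) \<noteq> 2)"

definition subnet :: "plane_net \<Rightarrow> plane_net \<Rightarrow> bool" where
  "subnet G' G \<longleftrightarrow> geodesic_net G' \<and> geodesic_net G \<and>
     verts G' \<subseteq> verts G \<and> edges G' \<subseteq> edges G \<and> bdry G' \<subseteq> bdry G"

definition irreducible_net :: "plane_net \<Rightarrow> bool" where
  "irreducible_net G \<longleftrightarrow> geodesic_net G \<and>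
     (\<forall>G'. subnet G' G \<longrightarrow> G' = G \<or> (\<exists>p. verts G' = {p}))"

end

(* The net is the arrangement of 38 segments joining the corners of the rectangle with vertices
   (+-8/5, +-1) and 12 hubs, symmetric under both reflections.  Its other vertices are 13 simple
   crossings of the segments, where balance is automatic.  The hubs are balanced exactly if their
   coordinates (six unknowns, by symmetry) are a critical point of the total length, a convex sum
   of norms.  A quadratic lower bound on each norm around an approximate solution shows that the
   length is strictly larger on the boundary of a cube of side 2/10000 than at its centre; so it
   has a minimum, hence a critical point, inside.  All the orientations of triples of vertices that
   determine the arrangement are constant on that cube and are found by integer arithmetic.

   Irreducibility: a subnet that contains an edge on a segment contains the whole segment, since
   at a simple crossing of two lines a balanced set of edges goes straight through.  At a hub of
   degree 3 or 5 without opposite edges no proper nonempty set of edges is balanced, as one of the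
   set and its complement would have at most two edges.  All segments are linked through hubs. *)
theory Submission
  imports Defs
begin

section \<open>Segments in the plane\<close>

text \<open>The obstacle is that the hubs are only known to exist near a rational point, so no
  incidence may rest on a numerical coincidence. What must hold exactly is either the vanishing of a
  partial derivative or a consequence of the reflections; everything else is a strict inequality
  that survives a small perturbation. Minimising over a compact cube suits this: rational estimates
  give an exact solution of the balance equations, although the solution itself is never written
  down. For the same reason the crossings are never located. They are counted as crossing pairs of
  segments, and different pairs give different points because no three segments cross pairwise. For
  irreducibility, corners are of no help: a subnet may use any part of the edges at a boundary
  vertex. All propagation therefore runs through hubs, and the segments must stay linked when the
  corners are disregarded. The corners matter only at the end, where a subnet with all edges must
  also be shown to have all four of them as boundary vertices.\<close>

lemma sgn_diff_closed_segment:
  fixes x b :: "'a::real_normed_vector"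
  assumes "w \<in> closed_segment x b" "w \<noteq> x"
  shows "sgn (w - x) = sgn (b - x)"
proof -
  obtain u where u: "0 \<le> u" "w = (1 - u) *\<^sub>R x + u *\<^sub>R b"
    using assms(1) by (auto simp: in_segment)
  then have "w - x = u *\<^sub>R (b - x)" by (simp add: algebra_simps)
  moreover have "u > 0" using u assms(2) by (cases "u = 0") auto
  ultimately show ?thesis by (simp add: sgn_scaleR)
qed

lemma sgn_diff_opposite:
  fixes x :: "'a::real_normed_vector"
  assumes "x \<in> closed_segment a b" "x \<noteq> a" "x \<noteq> b"
  shows "sgn (b - x) = - sgn (a - x)"
proof -
  obtain u where u: "0 \<le> u" "u \<le> 1" "x = (1 - u) *\<^sub>R a + u *\<^sub>R b"
    using assms(1) by (auto simp: in_segment)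
  then have ax: "a - x = u *\<^sub>R (a - b)" and bx: "b - x = (1 - u) *\<^sub>R (b - a)"
    by (simp_all add: algebra_simps)
  have "u > 0" "1 - u > 0" using u assms(2,3) by (cases "u = 0"; cases "u = 1"; auto)+
  then have "sgn (b - x) = sgn (b - a)" "sgn (a - x) = sgn (a - b)"
    unfolding ax bx by (simp_all add: sgn_scaleR)
  then show ?thesis using sgn_minus[of "a - b"] by simp
qed

lemma same_ray_closed_segment:
  fixes x :: "'a::real_normed_vector"
  assumes "sgn (w - x) = sgn (v - x)"
  shows "w \<in> closed_segment x v \<or> v \<in> closed_segment x w"
proof (cases "w = x \<or> v = x")
  case False
  have key: "p \<in> closed_segment x q"
    if "sgn (p - x) = sgn (q - x)" "norm (p - x) \<le> norm (q - x)" "q \<noteq> x" for p q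
  proof -
    define u where "u = norm (p - x) / norm (q - x)"
    have "p - x = norm (p - x) *\<^sub>R sgn (p - x)" by (cases "p = x") (simp_all add: sgn_div_norm)
    also have "\<dots> = u *\<^sub>R (q - x)" unfolding that(1) by (simp add: u_def sgn_div_norm
        divide_inverse)
    finally have "p = (1 - u) *\<^sub>R x + u *\<^sub>R q" by (simp add: algebra_simps)
    moreover have "0 \<le> u" "u \<le> 1" using that by (simp_all add: u_def divide_le_eq)
    ultimately show ?thesis by (auto simp: in_segment)
  qed
  show ?thesis
    using key[of w v] key[of v w] assms False by (metis linear)
qed auto

lemma closed_segment_split:
  fixes a b :: "'a::euclidean_space"
  assumes "x \<in> closed_segment a b" "w \<in> closed_segment a b"
  shows "w \<in> closed_segment x a \<or> w \<in> closed_segment x b"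
  using Un_closed_segment[OF assms(1)] assms(2) closed_segment_commute by blast

lemma closed_segment_between:
  fixes a b :: "'a::euclidean_space"
  assumes "x \<in> closed_segment a b" "w \<in> closed_segment x b"
  shows "x \<in> closed_segment w a"
proof -
  have "dist a b = dist a x + dist x b" "dist x b = dist x w + dist w b"
    using assms unfolding between_mem_segment[symmetric] between by simp_all
  then have "dist w a = dist w x + dist x a"
    using dist_triangle[of a b w] dist_triangle[of w a x] by (simp add: dist_commute)
  then show ?thesis unfolding between_mem_segment[symmetric] between .
qed


text \<open>On the line through \<open>a\<close> and \<open>b\<close> the two pairs become parameter
  intervals whose interiors share a point. By hypothesis neither contains an end of the other in its
  interior, so they coincide. This is the case of embeddedness in which two edges lie on the same
  segment.\<close>

lemma closed_segment_meet_collinear: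
  fixes a b :: "'a::euclidean_space"
  assumes "e \<subseteq> closed_segment a b" "f \<subseteq> closed_segment a b" "card e = 2" "card f = 2"
    and ef: "convex hull e \<inter> f \<subseteq> e" "convex hull f \<inter> e \<subseteq> f"
    and "x \<in> convex hull e" "x \<in> convex hull f" "x \<notin> e" "x \<notin> f"
  shows "e = f"
proof (cases "a = b")
  case True
  then have "e \<subseteq> {a}" using assms(1) by simp
  then have "card e \<le> 1" using card_mono[of "{a}" e] by simp
  then show ?thesis using assms(3) by simp
next
  case False
  define P where "P k = a + k *\<^sub>R (b - a)" for k :: real
  have inj: "P k = P l \<longleftrightarrow> k = l" for k l using False by (simp add: P_def)
  have P01: "P ` {0..1} = closed_segment a b"
    unfolding closed_segment_image_interval P_def by (auto simp: algebra_simps)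
  have hull: "convex hull {P k, P l} = P ` {k..l}" if "k \<le> l" for k l
  proof -
    have "linear (\<lambda>k. k *\<^sub>R (b - a))" by (simp add: linear_iff scaleR_left_distrib)
    from closed_segment_linear_image[OF this] have "closed_segment (P k) (P l) = P ` closed_segment k l"
      unfolding P_def closed_segment_translation by (simp add: image_image)
    then show ?thesis using that by (simp add: segment_convex_hull[symmetric] closed_segment_eq_real_ivl)
  qed
  have ends: "\<exists>k l. k < l \<and> g = {P k, P l}" if g: "g \<subseteq> closed_segment a b"
      "card g = 2" for g
  proof -
    obtain u v where uv: "g = {u, v}" "u \<noteq> v" using g(2) by (auto simp: card_2_iff)
    then have "u \<in> P ` {0..1}" "v \<in> P ` {0..1}" using g(1) P01 by auto
    then obtain k l where "u = P k" "v = P l" by blast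
    then show ?thesis using uv by (cases k l rule: linorder_cases) auto
  qed
  obtain k l where e: "k < l" "e = {P k, P l}" using ends[OF assms(1,3)] by blast
  obtain m n where f: "m < n" "f = {P m, P n}" using ends[OF assms(2,4)] by blast
  have "x \<in> P ` {k..l}" using assms(7) e hull[of k l] by simp
  then obtain t where t: "x = P t" "k \<le> t" "t \<le> l" by auto
  then have t': "k < t" "t < l" using assms(9) e by (auto simp: order_less_le)
  have "P t \<in> P ` {m..n}" using assms(8) f hull[of m n] t by simp
  then have "m \<le> t" "t \<le> n" by (auto simp: inj)
  then have t'': "m < t" "t < n" using assms(10) f t by (auto simp: order_less_le)
  have 1: "j = k \<or> j = l" if "j \<in> {k..l}" "j = m \<or> j = n" for j
  proof -
    have "P j \<in> convex hull e \<inter> f" using that e f hull[of k l] by auto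
    then have "P j \<in> e" using ef(1) by blast
    then show ?thesis using e inj by auto
  qed
  have 2: "j = m \<or> j = n" if "j \<in> {m..n}" "j = k \<or> j = l" for j
  proof -
    have "P j \<in> convex hull f \<inter> e" using that e f hull[of m n] by auto
    then have "P j \<in> f" using ef(2) by blast
    then show ?thesis using f inj by auto
  qed
  have "k = m" using 1[of m] 2[of k] t' t'' by (cases k m rule: linorder_cases) auto
  moreover have "l = n" using 1[of n] 2[of l] t' t'' by (cases l n rule: linorder_cases) auto
  ultimately show ?thesis using e f by simp
qed

section \<open>Nets cut out by a finite arrangement of segments\<close>

text \<open>Interface between the theory of nets and the concrete arrangement.
  \<open>meet_ends\<close> keeps ends out of the interior of other segments, and
  \<open>no_triple\<close> leaves only simple crossings elsewhere. \<open>linked\<close> spreads a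
  set of segments only through ends outside \<open>B\<close>, since balance says nothing at boundary
  vertices. \<open>unbalanced\<close> prevents a subnet with all edges from having fewer boundary
  vertices.\<close>

locale segment_net =
  fixes S :: "(real ^ 2) set set" and B :: "(real ^ 2) set"
  assumes finite_S: "finite S"
    and card_S: "s \<in> S \<Longrightarrow> card s = 2"
    and nonempty_S: "S \<noteq> {}"
    and B_subset: "B \<subseteq> \<Union>S"
    and meet_ends: "\<lbrakk>s \<in> S; t \<in> S; s \<noteq> t; x \<in> convex hull s; x \<in>
        convex hull t; x \<in> \<Union>S\<rbrakk> \<Longrightarrow> x \<in> s \<inter> t"
    and meet_unique: "\<lbrakk>s \<in> S; t \<in> S; s \<noteq> t; x \<in> convex hull s; x \<in>
        convex hull t;
      y \<in> convex hull s; y \<in> convex hull t\<rbrakk> \<Longrightarrow> x = y"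
    and no_triple: "\<lbrakk>s \<in> S; t \<in> S; r \<in> S; x \<in> convex hull s; x \<in> convex
        hull t; x \<in> convex hull r;
      x \<notin> \<Union>S\<rbrakk> \<Longrightarrow> s = t \<or> s = r \<or> t = r"
    and linked: "\<lbrakk>T \<subseteq> S; T \<noteq> {}; \<And>v s t. \<lbrakk>v \<in> \<Union>S -
        B; s \<in> S; t \<in> T; v \<in> s; v \<in> t\<rbrakk> \<Longrightarrow> s \<in> T\<rbrakk>
        \<Longrightarrow> T = S"
    and connected_S: "\<lbrakk>u \<in> \<Union>S; v \<in> \<Union>S\<rbrakk> \<Longrightarrow> (u,
        v) \<in> {(x, y). {x, y} \<in> S}\<^sup>*"
    and balanced: "v \<in> \<Union>S - B \<Longrightarrow> (\<Sum>w\<in>{w. {v, w} \<in> S}. sgn (w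
        - v)) = 0"
    and indecomposable: "\<lbrakk>v \<in> \<Union>S - B; N \<subseteq> {w. {v, w} \<in> S}; N
        \<noteq> {}; (\<Sum>w\<in>N. sgn (w - v)) = 0\<rbrakk>
      \<Longrightarrow> N = {w. {v, w} \<in> S}"
    and unbalanced: "v \<in> B \<Longrightarrow> (\<Sum>w\<in>{w. {v, w} \<in> S}. sgn (w - v))
        \<noteq> 0"
    and degree: "v \<in> \<Union>S - B \<Longrightarrow> card {w. {v, w} \<in> S} \<noteq> 2"
begin

definition crossings :: "(real ^ 2) set" where
  "crossings = {x. x \<notin> \<Union>S \<and> (\<exists>s\<in>S. \<exists>t\<in>S. s \<noteq> t
      \<and> x \<in> convex hull s \<and> x \<in> convex hull t)}"

definition V :: "(real ^ 2) set" where "V = \<Union>S \<union> crossings"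

text \<open>The last condition excludes vertices between the two ends, so the edges on a segment are
  its pieces between consecutive vertices.\<close>

definition E :: "(real ^ 2) set set" where
  "E = {e. e \<subseteq> V \<and> card e = 2 \<and> (\<exists>s\<in>S. e \<subseteq> convex hull s)
      \<and> convex hull e \<inter> V = e}"

definition net :: plane_net where "net = \<lparr>verts = V, edges = E, bdry = B\<rparr>"

lemma net_simps [simp]: "verts net = V" "edges net = E" "bdry net = B"
  by (simp_all add: net_def)

lemma segment_ends:
  assumes "s \<in> S" "a \<in> s"
  obtains b where "s = {a, b}" "b \<noteq> a"
  using card_S[OF assms(1)] assms(2) by (auto simp: card_2_iff)

lemma finite_crossings: "finite crossings"
proof (rule finite_subset)
  show "crossings \<subseteq> (\<Union>s\<in>S. \<Union>t\<in>S - {s}. convex hull s \<inter> convex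
      hull t)"
    unfolding crossings_def by blast
  have "finite (convex hull s \<inter> convex hull t)" if "s \<in> S" "t \<in> S - {s}" for s t
  proof -
    have "\<exists>y. convex hull s \<inter> convex hull t \<subseteq> {y}"
      using meet_unique[of s t] that by blast
    then show ?thesis using finite_subset by blast
  qed
  then show "finite (\<Union>s\<in>S. \<Union>t\<in>S - {s}. convex hull s \<inter> convex hull t)"
    using finite_S by blast
qed

lemma finite_V: "finite V"
proof -
  have "finite s" if "s \<in> S" for s using card_S[OF that] by (simp add: card_ge_0_finite)
  then show ?thesis unfolding V_def using finite_crossings finite_S by blast
qed

lemma end_on_segment: "\<lbrakk>v \<in> \<Union>S; s \<in> S; v \<in> convex hull s\<rbrakk>
    \<Longrightarrow> v \<in> s"
  using meet_ends[of s _ v] hull_inc by (metis IntD1 UnionE)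

lemma crossing_on_segment: "\<lbrakk>x \<in> V; s \<in> S; x \<in> convex hull s; x \<notin>
    s\<rbrakk> \<Longrightarrow> x \<in> crossings"
  unfolding V_def using end_on_segment by blast

lemma on_segment:
  assumes "x \<in> V"
  obtains s where "s \<in> S" "x \<in> convex hull s"
proof (cases "x \<in> \<Union>S")
  case True
  then obtain s where "s \<in> S" "x \<in> s" by blast
  then show ?thesis using that hull_inc[of x s convex] by blast
next
  case False
  then have "x \<in> crossings" using assms by (simp add: V_def)
  then show ?thesis using that unfolding crossings_def by blast
qed

text \<open>Only finitely many vertices lie on the segment, so one of those different from
  \<open>x\<close> is nearest to \<open>x\<close>.\<close>

lemma next_vertex:
  assumes "x \<in> V" "b \<in> V" "b \<noteq> x"
  obtains w where "w \<in> V" "w \<noteq> x" "w \<in> closed_segment x b" "closed_segment x w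
      \<inter> V = {x, w}"
proof -
  define A where "A = closed_segment x b \<inter> V - {x}"
  have "finite A" "b \<in> A" using finite_V assms by (auto simp: A_def)
  then obtain w where w: "w \<in> A" "\<And>y. y \<in> A \<Longrightarrow> dist x w \<le> dist x y"
    using ex_is_arg_min_if_finite[of A "dist x"] by (auto simp: is_arg_min_linorder)
  have "y = w" if y: "y \<in> closed_segment x w" "y \<in> V" "y \<noteq> x" for y
  proof -
    have "y \<in> A" using w(1) y subset_closed_segment[of x w x b] by (auto simp: A_def)
    then have "dist x w \<le> dist x y" by (rule w(2))
    moreover have "dist x w = dist x y + dist y w"
      using y(1) unfolding between_mem_segment[symmetric] between .
    ultimately show ?thesis by simp
  qed
  then have "closed_segment x w \<inter> V = {x, w}" using w(1) assms(1) by (auto simp: A_def)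
  then show ?thesis using that[of w] w(1) by (auto simp: A_def)
qed

lemma edgeI:
  assumes "s \<in> S" "x \<in> V" "w \<in> V" "x \<in> convex hull s" "w \<in> convex hull s" "w
      \<noteq> x"
    "closed_segment x w \<inter> V = {x, w}"
  shows "{x, w} \<in> E"
  using assms unfolding E_def by (auto simp: segment_convex_hull)

lemma edgeD:
  assumes "{x, w} \<in> E"
  shows "x \<in> V" "w \<in> V" "x \<noteq> w" "closed_segment x w \<inter> V = {x, w}"
  using assms unfolding E_def by (auto simp: segment_convex_hull card_2_iff doubleton_eq_iff)

lemma edge_direction_unique:
  assumes "{x, w} \<in> E" "{x, v} \<in> E" "sgn (w - x) = sgn (v - x)"
  shows "w = v"
  using same_ray_closed_segment[OF assms(3)]
proof
  assume "w \<in> closed_segment x v"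
  then have "w \<in> closed_segment x v \<inter> V" using edgeD(2)[OF assms(1)] by simp
  then show ?thesis using edgeD(3)[OF assms(1)] edgeD(4)[OF assms(2)] by simp
next
  assume "v \<in> closed_segment x w"
  then have "v \<in> closed_segment x w \<inter> V" using edgeD(2)[OF assms(2)] by simp
  then show ?thesis using edgeD(3)[OF assms(2)] edgeD(4)[OF assms(1)] by simp
qed

section \<open>Directions of edges at a vertex\<close>

text \<open>Read off from the segments through \<open>x\<close>, without knowing where the next
  vertex lies. As different edges at \<open>x\<close> have different directions, balance becomes a
  statement about this set.\<close>

definition dirs :: "real ^ 2 \<Rightarrow> (real ^ 2) set" where
  "dirs x = (\<lambda>w. sgn (w - x)) ` {b. \<exists>s\<in>S. b \<in> s \<and> x \<in> convex hull s
      \<and> b \<noteq> x}"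

lemma inj_on_directions: "inj_on (\<lambda>w. sgn (w - x)) (neighbours net x)"
  unfolding inj_on_def neighbours_def using edge_direction_unique by auto

lemma next_edge:
  assumes "s \<in> S" "x \<in> V" "x \<in> convex hull s" "b \<in> s" "b \<noteq> x"
  obtains w where "{x, w} \<in> E" "w \<in> closed_segment x b" "w \<in> convex hull s" "sgn (w - x)
      = sgn (b - x)"
proof -
  have "b \<in> V" using assms unfolding V_def by blast
  then obtain w where w: "w \<in> V" "w \<noteq> x" "w \<in> closed_segment x b" "closed_segment x w
      \<inter> V = {x, w}"
    using next_vertex assms(2,5) by blast
  have "closed_segment x b \<subseteq> convex hull s"
    using assms(3,4) by (simp add: closed_segment_subset hull_inc)
  then have "w \<in> convex hull s" using w(3) by blast
  then show ?thesis
    using that edgeI[OF assms(1,2) w(1) assms(3) _ w(2,4)] w(3) sgn_diff_closed_segment[OF w(3,2)]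
        by blast
qed

lemma directions_net:
  assumes "x \<in> V"
  shows "(\<lambda>w. sgn (w - x)) ` neighbours net x = dirs x"
proof
  show "(\<lambda>w. sgn (w - x)) ` neighbours net x \<subseteq> dirs x"
  proof clarify
    fix w assume "w \<in> neighbours net x"
    then have e: "{x, w} \<in> E" by (simp add: neighbours_def)
    then obtain s where s: "s \<in> S" "x \<in> convex hull s" "w \<in> convex hull s" unfolding
        E_def by blast
    obtain a b where ab: "s = {a, b}" using card_S[OF s(1)] by (auto simp: card_2_iff)
    have "w \<in> closed_segment x a \<or> w \<in> closed_segment x b"
      using closed_segment_split[of x a b w] s ab by (simp add: segment_convex_hull)
    then obtain c where c: "c \<in> s" "w \<in> closed_segment x c" using ab by blast
    have "w \<noteq> x" using edgeD[OF e] by simp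
    then have "sgn (w - x) = sgn (c - x)" "c \<noteq> x" using c(2) sgn_diff_closed_segment by auto
    then show "sgn (w - x) \<in> dirs x" unfolding dirs_def using s c by blast
  qed
  show "dirs x \<subseteq> (\<lambda>w. sgn (w - x)) ` neighbours net x"
  proof
    fix d assume "d \<in> dirs x"
    then obtain s b where "s \<in> S" "b \<in> s" "x \<in> convex hull s" "b \<noteq> x" "d = sgn (b
        - x)"
      unfolding dirs_def by blast
    then show "d \<in> (\<lambda>w. sgn (w - x)) ` neighbours net x"
      using next_edge[OF _ assms] by (metis image_eqI mem_Collect_eq neighbours_def net_simps(2))
  qed
qed

lemma sum_directions:
  assumes "N \<subseteq> neighbours net x"
  shows "(\<Sum>w\<in>N. sgn (w - x)) = \<Sum>((\<lambda>w. sgn (w - x)) ` N)"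
  using inj_on_subset[OF inj_on_directions assms] by (simp add: sum.reindex)

text \<open>A segment through an end of \<open>S\<close> must itself end there, and two segments
  leaving it in the same direction would share more than one point.\<close>

lemma end_directions:
  assumes "v \<in> \<Union>S"
  shows "dirs v = (\<lambda>w. sgn (w - v)) ` {w. {v, w} \<in> S}"
    and "inj_on (\<lambda>w. sgn (w - v)) {w. {v, w} \<in> S}"
proof -
  have "{b. \<exists>s\<in>S. b \<in> s \<and> v \<in> convex hull s \<and> b \<noteq> v} = {w. {v,
      w} \<in> S}"
  proof (intro equalityI subsetI CollectI)
    fix b assume "b \<in> {b. \<exists>s\<in>S. b \<in> s \<and> v \<in> convex hull s \<and> b
        \<noteq> v}"
    then obtain s where s: "s \<in> S" "b \<in> s" "v \<in> convex hull s" "b \<noteq> v" by blast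
    then have "v \<in> s" using end_on_segment assms by blast
    with s show "{v, b} \<in> S" by (metis segment_ends insertE singletonD)
  next
    fix w assume w: "w \<in> {w. {v, w} \<in> S}"
    then have "w \<noteq> v" using card_S[of "{v, w}"] by auto
    then show "\<exists>s\<in>S. w \<in> s \<and> v \<in> convex hull s \<and> w \<noteq> v"
      using w by (intro bexI[of _ "{v, w}"]) (auto simp: hull_inc)
  qed
  then show "dirs v = (\<lambda>w. sgn (w - v)) ` {w. {v, w} \<in> S}" unfolding dirs_def by simp
  show "inj_on (\<lambda>w. sgn (w - v)) {w. {v, w} \<in> S}"
  proof (rule inj_onI, rule ccontr)
    fix w u assume w: "w \<in> {w. {v, w} \<in> S}" and u: "u \<in> {w. {v, w} \<in> S}"
      and eq: "sgn (w - v) = sgn (u - v)" and ne: "w \<noteq> u"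
    have vw: "w \<noteq> v" "u \<noteq> v" using card_S[of "{v, w}"] card_S[of "{v, u}"] w u by auto
    have "{v, w} \<noteq> {v, u}" using ne vw by (auto simp: doubleton_eq_iff)
    then have m: "x = v" if "x \<in> closed_segment v w" "x \<in> closed_segment v u" for x
      using meet_unique[of "{v, w}" "{v, u}" x v] w u that by (auto simp: segment_convex_hull hull_inc)
    show False using same_ray_closed_segment[OF eq] m[of w] m[of u] vw by auto
  qed
qed


lemma crossing_segments:
  assumes "x \<in> crossings"
  obtains a b c d where "{a, b} \<in> S" "{c, d} \<in> S" "{a, b} \<noteq> {c, d}"
    "x \<in> closed_segment a b" "x \<in> closed_segment c d"
proof -
  obtain s t where st: "s \<in> S" "t \<in> S" "s \<noteq> t" "x \<in> convex hull s" "x \<in>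
      convex hull t"
    using assms unfolding crossings_def by blast
  obtain a b where ab: "s = {a, b}" using card_S[OF st(1)] by (auto simp: card_2_iff)
  obtain c d where cd: "t = {c, d}" using card_S[OF st(2)] by (auto simp: card_2_iff)
  show ?thesis using that[of a b c d] st ab cd by (simp add: segment_convex_hull)
qed

text \<open>By \<open>no_triple\<close> just the two given segments pass through \<open>x\<close>,
  and each contributes a pair of opposite directions. A direction common to both segments would give
  them a second common point.\<close>

lemma crossing_directions:
  assumes x: "x \<in> crossings" and S: "{a, b} \<in> S" "{c, d} \<in> S" "{a, b} \<noteq> {c, d}"
    and on: "x \<in> closed_segment a b" "x \<in> closed_segment c d"
  shows "dirs x = {sgn (a - x), - sgn (a - x), sgn (c - x), - sgn (c - x)}"
    and "sgn (c - x) \<noteq> sgn (a - x)" "sgn (c - x) \<noteq> - sgn (a - x)" "sgn (a - x)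
        \<noteq> 0" "sgn (c - x) \<noteq> 0"
proof -
  have notS: "x \<notin> \<Union>S" using x unfolding crossings_def by blast
  then have ne: "x \<noteq> a" "x \<noteq> b" "x \<noteq> c" "x \<noteq> d" using S by auto
  have opp: "sgn (b - x) = - sgn (a - x)" "sgn (d - x) = - sgn (c - x)"
    using sgn_diff_opposite on ne by auto
  have only: "s = {a, b} \<or> s = {c, d}" if "s \<in> S" "x \<in> convex hull s" for s
    using no_triple[OF that(1) S(1,2) that(2) _ _ notS] S(3) on by (auto simp: segment_convex_hull)
  have "{y. \<exists>s\<in>S. y \<in> s \<and> x \<in> convex hull s \<and> y \<noteq> x} = {a, b, c, d}"
  proof
    show "{y. \<exists>s\<in>S. y \<in> s \<and> x \<in> convex hull s \<and> y \<noteq> x}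
        \<subseteq> {a, b, c, d}" using only by blast
    show "{a, b, c, d} \<subseteq> {y. \<exists>s\<in>S. y \<in> s \<and> x \<in> convex hull s
        \<and> y \<noteq> x}"
      using S on ne unfolding segment_convex_hull by blast
  qed
  then show "dirs x = {sgn (a - x), - sgn (a - x), sgn (c - x), - sgn (c - x)}"
    unfolding dirs_def using opp by auto
  have diff: "sgn (u - x) \<noteq> sgn (v - x)" if uv: "u \<in> {a, b}" "v \<in> {c, d}" for u v
  proof
    assume "sgn (u - x) = sgn (v - x)"
    then consider "u \<in> closed_segment x v" | "v \<in> closed_segment x u"
      using same_ray_closed_segment by blast
    moreover have "closed_segment x v \<subseteq> closed_segment c d" "closed_segment x u
        \<subseteq> closed_segment a b"
      using uv on by (auto simp: subset_closed_segment)
    ultimately have "\<exists>y\<in>{u, v}. y \<in> closed_segment a b \<and> y \<in> closed_segment c d"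
      using uv by (metis ends_in_segment insertCI insertE singletonD subsetD)
    then have "\<exists>y\<in>{u, v}. y = x"
      using meet_unique[OF S(1,2,3) _ _, of _ x] on unfolding segment_convex_hull by blast
    then show False using uv ne by auto
  qed
  show "sgn (c - x) \<noteq> sgn (a - x)" using diff[of a c] by simp
  show "sgn (c - x) \<noteq> - sgn (a - x)" using diff[of b c] opp by simp
  show "sgn (a - x) \<noteq> 0" "sgn (c - x) \<noteq> 0" using ne by (auto simp: sgn_zero_iff)
qed

lemma card_neighbours_net: "x \<in> V \<Longrightarrow> card (neighbours net x) = card (dirs x)"
  using card_image[OF inj_on_directions, of x] directions_net[of x] by simp

lemma balanced_at_net: "x \<in> V \<Longrightarrow> balanced_at net x \<longleftrightarrow>
    \<Sum>(dirs x) = 0"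
  unfolding balanced_at_def using sum_directions[of "neighbours net x" x] directions_net[of x] by simp

lemma sum_dirs_end:
  assumes "v \<in> \<Union>S" "N \<subseteq> {w. {v, w} \<in> S}"
  shows "\<Sum>((\<lambda>w. sgn (w - v)) ` N) = (\<Sum>w\<in>N. sgn (w - v))"
  using inj_on_subset[OF end_directions(2)[OF assms(1)] assms(2)] by (simp add: sum.reindex)

lemma sum_dirs_crossing:
  assumes "x \<in> crossings"
  shows "\<Sum>(dirs x) = 0" "card (dirs x) = 4"
proof -
  obtain a b c d where *: "{a, b} \<in> S" "{c, d} \<in> S" "{a, b} \<noteq> {c, d}"
    "x \<in> closed_segment a b" "x \<in> closed_segment c d"
    using crossing_segments[OF assms] .
  note D = crossing_directions[OF assms *]
  \<comment> \<open>The sum runs over a set, so the four directions must be seen to be distinct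
    before they can cancel in pairs.\<close>
  have "p \<noteq> - p" if "p \<noteq> 0" for p :: "real ^ 2" using that by (simp add:
      eq_neg_iff_add_eq_0 scaleR_2[symmetric])
  then have "sgn (a - x) \<noteq> - sgn (a - x)" "sgn (c - x) \<noteq> - sgn (c - x)" using D(4,5)
      by blast+
  moreover have "- sgn (a - x) \<noteq> sgn (c - x)" "sgn (a - x) \<noteq> - sgn (c - x)" "- sgn (a
      - x) \<noteq> - sgn (c - x)"
    using D(2,3) by auto
  ultimately show "\<Sum>(dirs x) = 0" "card (dirs x) = 4" unfolding D(1) using D(2,3) by auto
qed

section \<open>The arrangement yields a geodesic net\<close>

lemma geodesic_net_net: "geodesic_net net"
proof -
  have "finite_graph net"
    unfolding finite_graph_def using finite_V by (auto simp: E_def)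
  moreover have "embedded_graph net"
    unfolding embedded_graph_def net_simps
  proof (intro conjI ballI impI)
    fix e assume "e \<in> E"
    then show "convex hull e \<inter> V = e" by (simp add: E_def)
  next
    fix e f assume e: "e \<in> E" and f: "f \<in> E" and ne: "e \<noteq> f"
    obtain s t where st: "s \<in> S" "e \<subseteq> convex hull s" "t \<in> S" "f \<subseteq> convex
        hull t"
      using e f unfolding E_def by blast
    have ef: "convex hull e \<inter> V = e" "convex hull f \<inter> V = f" "e \<subseteq> V" "f
        \<subseteq> V" "card e = 2" "card f = 2"
      using e f by (auto simp: E_def)
    \<comment> \<open>A common point of two edges that is not a vertex cannot lie on two different
      segments, since it would be a crossing; and on one segment it would make the edges
      equal.\<close>
    have "x \<in> V" if x: "x \<in> convex hull e" "x \<in> convex hull f" for x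
    proof (rule ccontr)
      assume xV: "x \<notin> V"
      have hs: "x \<in> convex hull s" "x \<in> convex hull t"
        using x st hull_mono[OF st(2), of convex] hull_mono[OF st(4), of convex] by (auto simp:
            hull_hull)
      show False
      proof (cases "s = t")
        case True
        obtain a b where ab: "s = {a, b}" using card_S[OF st(1)] by (auto simp: card_2_iff)
        have "e = f"
          using closed_segment_meet_collinear[of e a b f x] st ef x xV True ab
          unfolding segment_convex_hull by blast
        then show False using ne by simp
      next
        case False
        then show False using xV hs st unfolding V_def crossings_def by blast
      qed
    qed
    then show "convex hull e \<inter> convex hull f = e \<inter> f"
      using ef hull_subset[of e convex] hull_subset[of f convex] by blast
  qed
  moreover have "connected_graph net"
  proof -
    let ?R = "{(x, y). {x, y} \<in> E}"
    have symR: "(y, x) \<in> ?R\<^sup>*" if "(x, y) \<in> ?R\<^sup>*" for x y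
    proof -
      have "sym ?R" by (simp add: sym_def insert_commute)
      then show ?thesis using that by (blast intro: symD[OF sym_rtrancl])
    qed
    \<comment> \<open>Walk along the segment from \<open>x\<close> to its end \<open>a\<close>, from
      each vertex to the next; the number of vertices between \<open>a\<close> and the current one
      decreases.\<close>
    have seg: "(x, a) \<in> ?R\<^sup>*" if s: "s \<in> S" "a \<in> s" and x: "x \<in> V" "x \<in>
        convex hull s" for s a x
      using x
    proof (induction "card (V \<inter> closed_segment a x)" arbitrary: x rule: less_induct)
      case less
      show ?case
      proof (cases "a = x")
        case False
        then obtain w where w: "{x, w} \<in> E" "w \<in> closed_segment x a" "w \<in> convex hull s"
          using next_edge[OF s(1) less(2,3) s(2)] by blast
        have "x \<notin> closed_segment a w"
        proof
          assume "x \<in> closed_segment a w"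
          then have "dist a w = dist a x + dist x w" "dist x a = dist x w + dist w a"
            using w(2) unfolding between_mem_segment[symmetric] between by simp_all
          then have "dist x w = 0" by (simp add: dist_commute)
          then show False using edgeD(3)[OF w(1)] by simp
        qed
        moreover have "closed_segment a w \<subseteq> closed_segment a x"
          using w(2) by (simp add: subset_closed_segment closed_segment_commute)
        ultimately have "V \<inter> closed_segment a w \<subset> V \<inter> closed_segment a x"
            using less(2) by auto
        then have "card (V \<inter> closed_segment a w) < card (V \<inter> closed_segment a x)"
          using finite_V by (simp add: psubset_card_mono)
        then have "(w, a) \<in> ?R\<^sup>*" by (rule less(1)[OF _ edgeD(2)[OF w(1)] w(3)])
        moreover have "(x, w) \<in> ?R" using w(1) by simp
        ultimately show ?thesis by (rule converse_rtrancl_into_rtrancl[rotated])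
      next
        case True
        show ?thesis unfolding True by (rule rtrancl_refl)
      qed
    qed
    have to_end: "\<exists>a\<in>\<Union>S. (x, a) \<in> ?R\<^sup>*" if xV: "x \<in> V" for x
    proof -
      obtain s where s: "s \<in> S" "x \<in> convex hull s" using on_segment[OF xV] .
      obtain a where "a \<in> s" using card_S[OF s(1)] by (auto simp: card_2_iff)
      then show ?thesis using seg[OF s(1) _ xV s(2)] s(1) by blast
    qed
    \<comment> \<open>Each segment has become a path of edges, so paths in the arrangement turn into
      paths in the net.\<close>
    have ends: "(u, v) \<in> ?R\<^sup>*" if "(u, v) \<in> {(x, y). {x, y} \<in> S}\<^sup>*" for u v
      using that
    proof induction
      case (step y z)
      then have "{y, z} \<in> S" by simp
      then have "(y, z) \<in> ?R\<^sup>*" using seg[of "{y, z}" z y] by (auto simp: hull_inc V_def)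
      with step show ?case by simp
    qed simp
    have "(x, y) \<in> ?R\<^sup>*" if xy: "x \<in> V" "y \<in> V" for x y
    proof -
      obtain a b where ab: "a \<in> \<Union>S" "(x, a) \<in> ?R\<^sup>*" "b \<in> \<Union>S" "(y, b)
          \<in> ?R\<^sup>*"
        using to_end[OF xy(1)] to_end[OF xy(2)] by blast
      then show ?thesis using ends[OF connected_S[OF ab(1,3)]] symR[OF ab(4)] by (meson rtrancl_trans)
    qed
    moreover have "V \<noteq> {}"
      unfolding V_def using nonempty_S card_S by fastforce
    ultimately show ?thesis unfolding connected_graph_def by simp
  qed
  moreover have "balanced_at net x" if "x \<in> V - B" for x
  proof (cases "x \<in> crossings")
    case True
    then show ?thesis using that balanced_at_net sum_dirs_crossing(1) by simp
  next
    case False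
    then have x: "x \<in> \<Union>S" using that unfolding V_def by blast
    then have "\<Sum>(dirs x) = 0"
      using sum_dirs_end[OF x subset_refl] balanced[of x] that by (simp add: end_directions(1)[OF x])
    then show ?thesis using that balanced_at_net by simp
  qed
  ultimately show ?thesis
    unfolding geodesic_net_def balanced_verts_def using B_subset by (auto simp: V_def)
qed

lemma card_balanced_verts: "card (balanced_verts net) = card (\<Union>S - B) + card crossings"
proof -
  have "balanced_verts net = (\<Union>S - B) \<union> crossings"
    unfolding balanced_verts_def V_def using B_subset by (auto simp: V_def crossings_def)
  moreover have "finite (\<Union>S - B)" using finite_V by (simp add: V_def)
  moreover have "(\<Union>S - B) \<inter> crossings = {}" unfolding crossings_def by blast
  ultimately show ?thesis using finite_crossings by (simp add: card_Un_disjoint)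
qed

lemma no_degree_two_net: "no_degree_two net"
  unfolding no_degree_two_def
proof
  fix x assume "x \<in> balanced_verts net"
  then have x: "x \<in> V" "x \<notin> B" by (auto simp: balanced_verts_def)
  show "card (neighbours net x) \<noteq> 2"
  proof (cases "x \<in> crossings")
    case True
    then show ?thesis using card_neighbours_net[OF x(1)] sum_dirs_crossing(2) by simp
  next
    case False
    then have xS: "x \<in> \<Union>S" using x unfolding V_def by blast
    have "card (dirs x) = card {w. {x, w} \<in> S}"
      unfolding end_directions(1)[OF xS] using card_image[OF end_directions(2)[OF xS]] .
    then show ?thesis using degree[of x] xS x card_neighbours_net[OF x(1)] by simp
  qed
qed


section \<open>Subnets and irreducibility\<close>

lemma subnet_full:
  assumes G': "subnet G' net" and nonempty: "edges G' \<noteq> {}"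
  shows "G' = net"
proof -
  have net': "geodesic_net G'" "verts G' \<subseteq> V" "edges G' \<subseteq> E" "bdry G' \<subseteq> B"
    using G' by (simp_all add: subnet_def)
  have fin': "e \<subseteq> verts G'" if "e \<in> edges G'" for e
    using net'(1) that by (simp add: geodesic_net_def finite_graph_def)
  \<comment> \<open>Passing from edges of \<open>G'\<close> to their directions turns balance into a
    statement about a subset of \<open>dirs x\<close>, whose structure is known.\<close>
  define D where "D x = (\<lambda>w. sgn (w - x)) ` neighbours G' x" for x
  have nb: "neighbours G' x \<subseteq> neighbours net x" for x
    using net'(3) by (auto simp: neighbours_def)
  have D_dirs: "D x \<subseteq> dirs x" if "x \<in> V" for x
    unfolding D_def using directions_net[OF that] nb by blast
  \<comment> \<open>This includes vertices outside \<open>G'\<close>, where \<open>D x\<close> is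
    empty, so that later steps need not ask whether \<open>x\<close> belongs to
    \<open>G'\<close>.\<close>
  have D_bal: "\<Sum>(D x) = 0" if "x \<in> V" "x \<notin> bdry G'" for x
  proof (cases "x \<in> verts G'")
    case True
    then have "balanced_at G' x" using net'(1) that by (simp add: geodesic_net_def balanced_verts_def)
    then show ?thesis unfolding balanced_at_def D_def sum_directions[OF nb] .
  next
    case False
    then have "neighbours G' x = {}" using fin' by (auto simp: neighbours_def)
    then show ?thesis by (simp add: D_def)
  qed
  have D_iff: "sgn (w - x) \<in> D x \<longleftrightarrow> {x, w} \<in> edges G'" if "{x, w} \<in>
      E" for x w
  proof
    assume "sgn (w - x) \<in> D x"
    then obtain v where v: "{x, v} \<in> edges G'" "sgn (w - x) = sgn (v - x)"
      by (auto simp: D_def neighbours_def)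
    then have "w = v" using edge_direction_unique[OF that] net'(3) by blast
    then show "{x, w} \<in> edges G'" using v(1) by simp
  next
    assume "{x, w} \<in> edges G'"
    then show "sgn (w - x) \<in> D x" by (simp add: D_def neighbours_def)
  qed
  have pass: "sgn (b - x) \<in> D x \<longleftrightarrow> sgn (a - x) \<in> D x"
    if ab: "{a, b} \<in> S" "x \<in> closed_segment a b" and x: "x \<in> crossings" for a b x
  proof -
    have xV: "x \<in> V" "x \<notin> \<Union>S" using x by (auto simp: V_def crossings_def)
    then have "x \<notin> bdry G'" using net'(4) B_subset by blast
    then have sum: "\<Sum>(D x) = 0" using D_bal xV by blast
    have "x \<noteq> a" "x \<noteq> b" using xV ab by auto
    then have opp: "sgn (b - x) = - sgn (a - x)" using sgn_diff_opposite ab(2) by blast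
    obtain s where s: "s \<in> S" "s \<noteq> {a, b}" "x \<in> convex hull s"
      using x unfolding crossings_def by blast
    obtain c d where cd: "s = {c, d}" using card_S[OF s(1)] by (auto simp: card_2_iff)
    define p where "p = sgn (a - x)"
    define q where "q = sgn (c - x)"
    have "x \<in> closed_segment c d" using s cd by (simp add: segment_convex_hull)
    note dir = crossing_directions[OF x ab(1) s(1)[unfolded cd] _ ab(2) this, folded p_def q_def]
    have dirs: "D x \<subseteq> {p, - p, q, - q}" and pq: "q \<noteq> p" "q \<noteq> - p" "p
        \<noteq> 0" "q \<noteq> 0"
      using dir D_dirs[OF xV(1)] s(2) cd by auto
    have neg: "r \<noteq> - r" if "r \<noteq> 0" for r :: "real ^ 2"
      using that by (simp add: eq_neg_iff_add_eq_0 scaleR_2[symmetric])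
    \<comment> \<open>If \<open>r\<close> lacked its opposite, it would have to be cancelled by some
      of \<open>q\<close> and \<open>- q\<close>, hence be 0, \<open>q\<close> or
      \<open>- q\<close>.\<close>
    have key: "- r \<in> D x" if r: "r \<in> D x" "r = p \<or> r = - p" for r
    proof (rule ccontr)
      assume "- r \<notin> D x"
      then have "D x = insert r (D x \<inter> {q, - q})" using r dirs by auto
      moreover have "r \<notin> {q, - q}" using r(2) pq by auto
      ultimately have "\<Sum>(D x) = r + \<Sum>(D x \<inter> {q, - q})"
        by (metis (no_types, lifting) Int_iff finite.emptyI finite.insertI finite_Int sum.insert)
      then have sum0: "r + \<Sum>(D x \<inter> {q, - q}) = 0" using sum by simp
      have "\<Sum>(D x \<inter> {q, - q}) = (if q \<in> D x then q else 0) + (if - q \<in> D x then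
          - q else 0)"
        using neg[OF pq(4)] by (simp add: Int_insert_right)
      then have "r = 0 \<or> r = - q \<or> r = q"
        using sum0 by (simp add: add_eq_0_iff split: if_splits)
      then show False using r(2) pq by auto
    qed
    show ?thesis using key[of p] key[of "- p"] by (auto simp: opp p_def)
  qed
  \<comment> \<open>The decision taken at \<open>a\<close> is carried along the segment: between
    consecutive vertices both sides speak of the same edge, and at a crossing \<open>pass\<close>
    transfers it to the next one.\<close>
  have const: "sgn (b - x) \<in> D x \<longleftrightarrow> sgn (b - a) \<in> D a"
    if ab: "{a, b} \<in> S" and x: "x \<in> V" "x \<in> closed_segment a b" "x \<noteq> b" for a b x
    using x
  proof (induction "card (V \<inter> closed_segment a x)" arbitrary: x rule: less_induct)
    case less
    show ?case
    proof (cases "x = a")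
      case False
      have xs: "x \<in> convex hull {a, b}" using less(3) by (simp add: segment_convex_hull)
      have xX: "x \<in> crossings"
        using crossing_on_segment[OF less(2) ab xs] False less(4) by simp
      obtain w where w: "{x, w} \<in> E" "w \<in> closed_segment x a" "w \<in> convex hull {a, b}"
        "sgn (w - x) = sgn (a - x)"
        using next_edge[OF ab less(2) xs, of a] False by blast
      have wa: "x \<in> closed_segment w b"
        using closed_segment_between[of x b a w] less(3) w(2) by (simp add: closed_segment_commute)
      have "w \<noteq> b"
      proof
        assume "w = b"
        then show False using wa less(4) by simp
      qed
      have "x \<notin> closed_segment a w"
      proof
        assume "x \<in> closed_segment a w"
        then have "dist a w = dist a x + dist x w" "dist x a = dist x w + dist w a"
          using w(2) unfolding between_mem_segment[symmetric] between by simp_all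
        then have "dist x w = 0" by (simp add: dist_commute)
        then show False using edgeD(3)[OF w(1)] by simp
      qed
      moreover have "closed_segment a w \<subseteq> closed_segment a x"
        using w(2) by (simp add: subset_closed_segment closed_segment_commute)
      ultimately have "V \<inter> closed_segment a w \<subset> V \<inter> closed_segment a x" using
          less(2) by auto
      then have "card (V \<inter> closed_segment a w) < card (V \<inter> closed_segment a x)"
        using finite_V by (simp add: psubset_card_mono)
      then have IH: "sgn (b - w) \<in> D w \<longleftrightarrow> sgn (b - a) \<in> D a"
        using less(1)[OF _ edgeD(2)[OF w(1)] _ \<open>w \<noteq> b\<close>] w(3) by (simp add:
            segment_convex_hull)
      have "sgn (x - w) = sgn (b - w)"
        using sgn_diff_closed_segment[OF wa] edgeD(3)[OF w(1)] by simp
      moreover have "{w, x} \<in> E" using w(1) by (simp add: insert_commute)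
      ultimately have "sgn (b - w) \<in> D w \<longleftrightarrow> {x, w} \<in> edges G'"
        using D_iff[of w x] by (simp add: insert_commute)
      also have "\<dots> \<longleftrightarrow> sgn (a - x) \<in> D x" using D_iff[OF w(1)] w(4) by simp
      also have "\<dots> \<longleftrightarrow> sgn (b - x) \<in> D x" using pass[OF ab less(3) xX]
          by simp
      finally show ?thesis using IH by simp
    qed simp
  qed
  have edge_iff: "e \<in> edges G' \<longleftrightarrow> sgn (b - a) \<in> D a"
    if ab: "{a, b} \<in> S" and e: "e \<in> E" "e \<subseteq> convex hull {a, b}" for a b e
  proof -
    obtain x w where xw: "e = {x, w}" using e(1) by (auto simp: E_def card_2_iff)
    have towards: "{x, w} \<in> edges G' \<longleftrightarrow> sgn (b - a) \<in> D a"
      if xw: "{x, w} \<in> E" "x \<in> closed_segment a b" "w \<in> closed_segment x b" for x w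
    proof -
      note xV = edgeD[OF xw(1)]
      have "sgn (w - x) = sgn (b - x)" using sgn_diff_closed_segment[OF xw(3)] xV(3) by simp
      moreover have "x \<noteq> b" using xw(3) xV(3) by auto
      ultimately show ?thesis using const[OF ab xV(1) xw(2)] D_iff[OF xw(1)] by simp
    qed
    have on: "x \<in> closed_segment a b" "w \<in> closed_segment a b"
      using e(2) xw by (simp_all add: segment_convex_hull)
    from closed_segment_split[OF on] show ?thesis
    proof
      assume "w \<in> closed_segment x b"
      then show ?thesis using towards[of x w] on e xw by simp
    next
      assume "w \<in> closed_segment x a"
      then have "x \<in> closed_segment w b"
        using closed_segment_between[of x b a w] on(1) by (simp add: closed_segment_commute)
      then show ?thesis using towards[of w x] on e xw by (simp add: insert_commute)
    qed
  qed
  \<comment> \<open>By \<open>edge_iff\<close> and \<open>T_iff\<close>, a segment outside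
    \<open>T\<close> contributes no edge to \<open>G'\<close> at all, so \<open>G'\<close> is
    described by a set of whole segments.\<close>
  define T where "T = {s \<in> S. \<forall>e\<in>E. e \<subseteq> convex hull s \<longrightarrow> e
      \<in> edges G'}"
  have T_iff: "{a, b} \<in> T \<longleftrightarrow> sgn (b - a) \<in> D a" if ab: "{a, b} \<in> S"
      for a b
  proof
    assume T: "{a, b} \<in> T"
    \<comment> \<open>An actual edge on the segment has to be produced here, since the condition in
      \<open>T\<close> could otherwise hold vacuously.\<close>
    have "a \<in> V" "a \<noteq> b" using ab card_S[OF ab] by (auto simp: V_def)
    then obtain w where "{a, w} \<in> E" "w \<in> convex hull {a, b}"
      using next_edge[OF ab, of a b] by (auto simp: hull_inc)
    then have w: "{a, w} \<in> E" "{a, w} \<subseteq> convex hull {a, b}" by (auto simp: hull_inc)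
    then have "{a, w} \<in> edges G'" using T by (simp add: T_def)
    then show "sgn (b - a) \<in> D a" using edge_iff[OF ab w] by simp
  next
    assume "sgn (b - a) \<in> D a"
    then show "{a, b} \<in> T" using edge_iff[OF ab] ab by (simp add: T_def)
  qed
  have T_cover: "\<exists>s\<in>T. e \<subseteq> convex hull s" if e: "e \<in> edges G'" for e
  proof -
    have eE: "e \<in> E" using e net'(3) by blast
    then obtain s where s: "s \<in> S" "e \<subseteq> convex hull s" by (auto simp: E_def)
    obtain a b where ab: "s = {a, b}" using card_S[OF s(1)] by (auto simp: card_2_iff)
    have "{a, b} \<in> T" using T_iff[of a b] edge_iff[of a b e] s ab e eE by blast
    then show ?thesis using s ab by blast
  qed
  have T_dirs: "D v = (\<lambda>w. sgn (w - v)) ` {w. {v, w} \<in> T}" if v: "v \<in> \<Union>S" for v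
  proof -
    have "D v \<subseteq> (\<lambda>w. sgn (w - v)) ` {w. {v, w} \<in> S}"
      using D_dirs[of v] end_directions(1)[OF v] v by (simp add: V_def)
    moreover have "{v, w} \<in> T \<longleftrightarrow> {v, w} \<in> S \<and> sgn (w - v) \<in> D v"
        for w
      using T_iff[of v w] by (auto simp: T_def)
    ultimately show ?thesis by auto
  qed
  have "T = S"
  proof (rule linked)
    show "T \<subseteq> S" by (auto simp: T_def)
    show "T \<noteq> {}" using nonempty T_cover by blast
    fix v s t assume v: "v \<in> \<Union>S - B" and s: "s \<in> S" "v \<in> s" and t: "t \<in> T" "v
        \<in> t"
    have tS: "t \<in> S" using t by (simp add: T_def)
    obtain w where w: "s = {v, w}" using segment_ends[OF s] .
    obtain u where u: "t = {v, u}" using segment_ends[OF tS t(2)] .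
    have vV: "v \<in> V" "v \<in> \<Union>S" using v by (auto simp: V_def)
    have sub: "{w. {v, w} \<in> T} \<subseteq> {w. {v, w} \<in> S}" by (auto simp: T_def)
    have "(\<Sum>w\<in>{w. {v, w} \<in> T}. sgn (w - v)) = \<Sum>(D v)"
      unfolding T_dirs[OF vV(2)] using sum_dirs_end[OF vV(2) sub] by simp
    also have "\<dots> = 0" using D_bal[OF vV(1)] v net'(4) by blast
    finally have "{w. {v, w} \<in> T} = {w. {v, w} \<in> S}"
      using indecomposable[OF v sub] t u by blast
    then show "s \<in> T" using s w by blast
  qed
  have E': "edges G' = E"
  proof
    show "E \<subseteq> edges G'"
    proof
      fix e assume e: "e \<in> E"
      then obtain s where "s \<in> S" "e \<subseteq> convex hull s" by (auto simp: E_def)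
      then show "e \<in> edges G'" using e \<open>T = S\<close> by (auto simp: T_def)
    qed
  qed (rule net'(3))
  have "V \<subseteq> verts G'"
  proof
    fix x assume x: "x \<in> V"
    obtain s where s: "s \<in> S" "x \<in> convex hull s" using on_segment[OF x] .
    obtain a b where ab: "s = {a, b}" "a \<noteq> b" using card_S[OF s(1)] by (auto simp: card_2_iff)
    obtain c where "c \<in> s" "c \<noteq> x" using ab by (cases "a = x") auto
    then obtain w where "{x, w} \<in> E" using next_edge[OF s(1) x s(2)] by blast
    then show "x \<in> verts G'" using fin' E' by blast
  qed
  then have V': "verts G' = V" using net'(2) by blast
  \<comment> \<open>A vertex of \<open>B\<close> outside \<open>bdry G'\<close> would have to be
    balanced in \<open>G'\<close>, although it carries all its edges there.\<close>
  have "B \<subseteq> bdry G'"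
  proof (rule subsetI, rule ccontr)
    fix v assume v: "v \<in> B" "v \<notin> bdry G'"
    then have vS: "v \<in> \<Union>S" using B_subset by blast
    then have "\<Sum>(D v) = 0" using D_bal v by (simp add: V_def)
    then show False
      using unbalanced[OF v(1)] sum_dirs_end[OF vS subset_refl] T_dirs[OF vS] \<open>T = S\<close>
          by simp
  qed
  then have "bdry G' = B" using net'(4) by blast
  then show ?thesis using E' V' by (intro plane_net.equality) simp_all
qed

lemma irreducible_net_net: "irreducible_net net"
  unfolding irreducible_net_def
proof (intro conjI allI impI geodesic_net_net)
  fix G' assume G': "subnet G' net"
  then have conn: "connected_graph G'" by (simp add: subnet_def geodesic_net_def)
  show "G' = net \<or> (\<exists>p. verts G' = {p})"
  proof (cases "edges G' = {}")
    case True
    obtain p where p: "p \<in> verts G'" using conn unfolding connected_graph_def by blast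
    have "q = p" if "q \<in> verts G'" for q
    proof -
      have "(p, q) \<in> {(x, y). {x, y} \<in> edges G'}\<^sup>*"
        using conn p that unfolding connected_graph_def by blast
      then show ?thesis using True by simp
    qed
    then show ?thesis using p by blast
  next
    case False
    then show ?thesis using subnet_full[OF G'] by simp
  qed
qed

end

section \<open>The combinatorics of the net\<close>

text \<open>Twice the signed area of the triangle, positive if \<open>p\<close>, \<open>q\<close>,
  \<open>r\<close> run counterclockwise.\<close>

definition orient :: "real ^ 2 \<Rightarrow> real ^ 2 \<Rightarrow> real ^ 2 \<Rightarrow> real" where
  "orient p q r = (q $ 1 - p $ 1) * (r $ 2 - p $ 2) - (q $ 2 - p $ 2) * (r $ 1 - p $ 1)"

text \<open>The orientation is affine in its third argument. The incidence lemmas below compare the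
  signs of this affine function at the two ends of a segment.\<close>

lemma orient_convex_combination:
  "orient p q ((1 - u) *\<^sub>R r + u *\<^sub>R s) = (1 - u) * orient p q r + u * orient p q s"
  by (simp add: orient_def algebra_simps)

lemma orient_closed_segment: "x \<in> closed_segment p q \<Longrightarrow> orient p q x = 0"
  by (auto simp: in_segment orient_convex_combination) (simp_all add: orient_def)

lemma orient_same_side:
  assumes "0 < orient p q r * orient p q s" "x \<in> closed_segment p q" "x \<in> closed_segment r s"
  shows False
proof -
  obtain u where u: "0 \<le> u" "u \<le> 1" "x = (1 - u) *\<^sub>R r + u *\<^sub>R s"
    using assms(3) by (auto simp: in_segment)
  have 0: "(1 - u) * orient p q r + u * orient p q s = 0"
    using orient_closed_segment[OF assms(2)] unfolding u(3) orient_convex_combination .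
  \<comment> \<open>Multiplying by \<open>orient p q r\<close> lets one inequality cover both signs
    that the two values may share.\<close>
  have "0 < (1 - u) * (orient p q r)\<^sup>2 + u * (orient p q r * orient p q s)"
  proof (cases "u = 0")
    case True
    then show ?thesis using assms(1) by auto
  next
    case False
    then have "0 < u * (orient p q r * orient p q s)" using u(1) assms(1) by simp
    moreover have "0 \<le> (1 - u) * (orient p q r)\<^sup>2" using u(2) by simp
    ultimately show ?thesis by simp
  qed
  also have "\<dots> = orient p q r * ((1 - u) * orient p q r + u * orient p q s)"
    by (simp add: power2_eq_square algebra_simps)
  finally show False using 0 by simp
qed

lemma orient_common_end:
  assumes "orient v u w \<noteq> 0" "x \<in> closed_segment v u" "x \<in> closed_segment v w"
  shows "x = v"
proof -
  obtain k where k: "x = (1 - k) *\<^sub>R v + k *\<^sub>R w" using assms(3) by (auto simp: in_segment)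
  have "(1 - k) * orient v u v + k * orient v u w = 0"
    using orient_closed_segment[OF assms(2)] unfolding k orient_convex_combination .
  then have "k = 0" using assms(1) by (simp add: orient_def)
  then show ?thesis using k by simp
qed

lemma orient_crossing_unique:
  assumes "orient p q r * orient p q s < 0"
    and "x \<in> closed_segment p q" "x \<in> closed_segment r s"
    and "y \<in> closed_segment p q" "y \<in> closed_segment r s"
  shows "x = y"
proof -
  obtain u where u: "x = (1 - u) *\<^sub>R r + u *\<^sub>R s" using assms(3) by (auto simp: in_segment)
  obtain v where v: "y = (1 - v) *\<^sub>R r + v *\<^sub>R s" using assms(5) by (auto simp: in_segment)
  have "(1 - u) * orient p q r + u * orient p q s = 0" "(1 - v) * orient p q r + v * orient p q s = 0"
    using orient_closed_segment[OF assms(2)] orient_closed_segment[OF assms(4)]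
    unfolding u v orient_convex_combination by auto
  then have "(u - v) * (orient p q s - orient p q r) = 0" by algebra
  moreover have "orient p q s \<noteq> orient p q r" using assms(1) by (auto simp: mult_less_0_iff)
  ultimately show ?thesis unfolding u v by simp
qed

lemma orient_crossing_interior:
  assumes "orient p q r * orient p q s < 0" "orient r s p * orient r s q < 0"
    and "x \<in> closed_segment p q" "x \<in> closed_segment r s"
  shows "x \<notin> {p, q, r, s}"
  using orient_closed_segment[OF assms(3)] orient_closed_segment[OF assms(4)] assms(1,2) by auto

text \<open>\<open>k\<close> and \<open>m\<close> are the parameters at which each segment meets the
  line of the other. Both denominators are, up to sign, the cross product of the two directions
  (\<open>opp\<close>), and once it is cleared the two points agree in each coordinate.\<close>

lemma orient_crossing_exists:
  assumes "orient p q r * orient p q s < 0" "orient r s p * orient r s q < 0"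
  obtains x where "x \<in> closed_segment p q" "x \<in> closed_segment r s"
proof -
  have frac: "0 \<le> a / (a - b) \<and> a / (a - b) \<le> 1 \<and> a - b \<noteq> 0" if "a * b < 0"
      for a b :: real
    using that by (auto simp: mult_less_0_iff divide_simps)
  define k where "k = orient r s p / (orient r s p - orient r s q)"
  define m where "m = orient p q r / (orient p q r - orient p q s)"
  note km = frac[OF assms(2), folded k_def] frac[OF assms(1), folded m_def]
  let ?x = "(1 - k) *\<^sub>R p + k *\<^sub>R q" and ?y = "(1 - m) *\<^sub>R r + m *\<^sub>R s"
  have k: "k * (orient r s p - orient r s q) = orient r s p" using km by (simp add: k_def)
  have m: "m * (orient p q r - orient p q s) = orient p q r" using km by (simp add: m_def)
  have opp: "orient p q r - orient p q s = - (orient r s p - orient r s q)"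
    by (simp add: orient_def algebra_simps)
  have "(orient r s p - orient r s q) * (?x $ i - ?y $ i) = 0" if "i = 1 \<or> i = 2" for i :: 2
  proof -
    have "(orient r s p - orient r s q) * (?x $ i - ?y $ i) =
        (orient r s p - orient r s q) * (p $ i - r $ i) + (k * (orient r s p - orient r s q)) * (q $
            i - p $ i)
        + (m * (orient p q r - orient p q s)) * (s $ i - r $ i)"
      unfolding opp by (simp add: algebra_simps)
    also have "\<dots> = 0" unfolding k m using that by (auto simp: orient_def algebra_simps)
    finally show ?thesis .
  qed
  then have "?x = ?y" using km by (simp add: vec_eq_iff forall_2)
  moreover have "?x \<in> closed_segment p q" "?y \<in> closed_segment r s"
    unfolding in_segment using km by blast+
  ultimately show ?thesis using that[of ?x] by simp
qed

lemma orient_opposite: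
  assumes "orient v u w \<noteq> 0"
  shows "sgn (u - v) + sgn (w - v) \<noteq> 0"
proof
  assume 0: "sgn (u - v) + sgn (w - v) = 0"
  have "norm (u - v) *\<^sub>R sgn (u - v) = u - v" "norm (w - v) *\<^sub>R sgn (w - v) = w - v"
    by (cases "u = v"; cases "w = v"; simp add: sgn_div_norm)+
  moreover have "sgn (w - v) = - sgn (u - v)" using 0 by (simp add: add_eq_0_iff)
  ultimately have e: "u - v = norm (u - v) *\<^sub>R sgn (u - v)" "w - v = - (norm (w - v) *\<^sub>R
      sgn (u - v))"
    by simp_all
  have "orient v u w = (u - v) $ 1 * (w - v) $ 2 - (u - v) $ 2 * (w - v) $ 1"
    by (simp add: orient_def)
  also have "\<dots> = 0" by (subst (1 2) e(1), subst (1 2) e(2)) simp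
  finally show False using assms by simp
qed

text \<open>The arguments are the signs of the coordinates, \<open>True\<close> for positive.
    \<open>Inner\<close> and \<open>Outer\<close> are the hubs
  off the axes.\<close>
datatype node = Corner bool bool | Inner bool bool | Outer bool bool | Horiz bool | Vertical bool

definition sg :: "bool \<Rightarrow> 'a::ring_1" where "sg s = (if s then 1 else - 1)"

text \<open>Units of 10^(-6). Corners are exact; for hubs this is the centre of the cube on which
  the length is minimised.\<close>

fun approx :: "node \<Rightarrow> int \<times> int" where
  "approx (Corner s t) = (sg s * 1600000, sg t * 1000000)"
| "approx (Inner s t) = (sg s * 625979, sg t * 118290)"
| "approx (Outer s t) = (sg s * 1027054, sg t * 100758)"
| "approx (Horiz s) = (sg s * 648773, 0)"
| "approx (Vertical t) = (0, sg t * 109677)"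

text \<open>The sign of the orientation of every triple of points whose coordinates, in units of
  $10^{-6}$, differ from \<^const>\<open>approx\<close> by at most 100, and 0 if this is not
      determined.\<close>

definition side :: "node \<Rightarrow> node \<Rightarrow> node \<Rightarrow> int" where
  "side i j k = (case (approx i, approx j, approx k) of ((px, py), (qx, qy), (rx, ry)) \<Rightarrow>
    let a = qx - px; b = ry - py; c = qy - py; d = rx - px;
      m = a * b - c * d; err = 200 * (\<bar>a\<bar> + \<bar>b\<bar> + \<bar>c\<bar> + \<bar>d\<bar>)
          + 80000
    in if err < m then 1 else if m < - err then - 1 else 0)"

section \<open>The concrete arrangement, decided by integer arithmetic\<close>

text \<open>Each segment is listed in one direction only, so that \<open>pairs\<close> meets every
  two segments once, and its second node is always a hub.\<close>

definition segs :: "(node \<times> node) list" where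
  "segs = (Horiz True, Horiz False) # (Vertical True, Vertical False) #
    concat (map (\<lambda>(s, t). [(Corner s t, Inner s t), (Corner (\<not> s) t, Inner s t),
      (Corner s t, Horiz s), (Inner s t, Horiz s), (Corner s t, Outer s t), (Corner s (\<not> t),
          Outer s t),
      (Inner s t, Outer s t), (Corner s t, Vertical t), (Inner s t, Vertical t)])
    [(True, True), (True, False), (False, True), (False, False)])"

primrec pairs :: "'a list \<Rightarrow> ('a \<times> 'a) list" where
  "pairs [] = []"
| "pairs (x # xs) = map (Pair x) xs @ pairs xs"

definition crossing :: "node \<times> node \<Rightarrow> node \<times> node \<Rightarrow> bool" where
  "crossing s t = (case (s, t) of ((i, j), (k, l)) \<Rightarrow>
    side i j k * side i j l = - 1 \<and> side k l i * side k l j = - 1)"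

definition apart :: "node \<times> node \<Rightarrow> node \<times> node \<Rightarrow> bool" where
  "apart s t = (case (s, t) of ((i, j), (k, l)) \<Rightarrow>
    side i j k * side i j l = 1 \<or> side k l i * side k l j = 1)"

text \<open>The approximation settles how the two segments meet. With a common node a nonzero sign
  suffices, as then they share nothing else. Without one, four determined signs always yield one of
  \<open>apart\<close> and \<open>crossing\<close>.\<close>

definition placed :: "node \<times> node \<Rightarrow> node \<times> node \<Rightarrow> bool" where
  "placed s t = (case (s, t) of ((i, j), (k, l)) \<Rightarrow>
    if i = k then side i j l \<noteq> 0 else if j = l then side j i k \<noteq> 0
    else if i = l then side i j k \<noteq> 0 else if j = k then side j i l \<noteq> 0
    else apart s t \<or> crossing s t)"

definition crossing_pairs :: "((node \<times> node) \<times> (node \<times> node)) list" where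
  "crossing_pairs = filter (\<lambda>(s, t). crossing s t) (pairs segs)"

lemma placed_segs: "list_all (\<lambda>(s, t). placed s t) (pairs segs)"
  by code_simp


lemma segs_proper: "list_all (\<lambda>(i, j). i \<noteq> j \<and> (j, i) \<notin> set segs) segs"
    "distinct segs"
  by code_simp+

text \<open>A point on three segments away from their ends, or one point serving two crossing pairs,
  would require three pairwise crossing segments. So this excludes triple points and tells the
  crossings apart.\<close>

lemma crossing_pairs_triangle_free:
  "list_all (\<lambda>(p, q). list_all (\<lambda>r. \<not> (crossing p r \<and> crossing q r)) segs)
      crossing_pairs"
  by code_simp

lemma length_crossing_pairs: "length crossing_pairs = 13"
  by code_simp

definition adjacent :: "node \<Rightarrow> node list" where
  "adjacent n = map snd (filter (\<lambda>p. fst p = n) segs) @ map fst (filter (\<lambda>p. snd p =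
      n) segs)"

definition hubs :: "node list" where
  "hubs = [Horiz True, Horiz False, Vertical True, Vertical False,
    Inner True True, Inner True False, Inner False True, Inner False False,
    Outer True True, Outer True False, Outer False True, Outer False False]"

text \<open>Opposite directions at a hub would give a collinear triple, which a nonzero sign
  excludes.\<close>

lemma hubs_no_opposite:
  "list_all (\<lambda>n. list_all (\<lambda>(j, k). side n j k \<noteq> 0) (pairs (adjacent n))) hubs"
  by code_simp

lemma pairs_cover: "\<lbrakk>x \<in> set xs; y \<in> set xs; x \<noteq> y\<rbrakk> \<Longrightarrow>
    (x, y) \<in> set (pairs xs) \<or> (y, x) \<in> set (pairs xs)"
  by (induction xs) auto

lemma pairs_members: "(x, y) \<in> set (pairs xs) \<Longrightarrow> x \<in> set xs \<and> y \<in> set xs"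
  by (induction xs) auto

lemma pairs_distinct:
  assumes "distinct xs"
  shows "distinct (pairs xs)" "(x, y) \<in> set (pairs xs) \<Longrightarrow> (y, x) \<notin> set
      (pairs xs)"
    "(x, y) \<in> set (pairs xs) \<Longrightarrow> x \<noteq> y"
  using assms
  by (induction xs) (auto dest: pairs_members simp: distinct_map inj_on_def)

section \<open>A critical point of the length\<close>

definition norm2 :: "real \<Rightarrow> real \<Rightarrow> real" where "norm2 x y = sqrt (x\<^sup>2
    + y\<^sup>2)"
text \<open>To second order the norm of \<open>(x, y)\<close> is its component \<open>s\<close>
    along a fixed unit vector plus
  \<open>t\<^sup>2 / (2 s)\<close>, where \<open>t\<close> is the orthogonal component.\<close>

lemma norm2_lower:
  assumes "al * x + be * y \<le> S" "\<bar>al * y - be * x\<bar> \<le> T" "0 \<le> w" "al\<^sup>2 +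
      be\<^sup>2 \<le> 1"
    "2 * w * S + w\<^sup>2 * T\<^sup>2 \<le> 1"
  shows "al * x + be * y + w * (al * y - be * x)\<^sup>2 \<le> norm2 x y"
proof -
  define s where "s = al * x + be * y"
  define t where "t = al * y - be * x"
  have "t\<^sup>2 \<le> T\<^sup>2" using assms(2) by (simp add: t_def abs_le_square_iff[symmetric])
  then have "w\<^sup>2 * t\<^sup>2 \<le> w\<^sup>2 * T\<^sup>2" by (simp add: mult_left_mono)
  moreover have "2 * w * s \<le> 2 * w * S" using assms(1,3) by (simp add: s_def mult_left_mono)
  ultimately have "2 * w * s + w\<^sup>2 * t\<^sup>2 \<le> 1" using assms(5) by linarith
  \<comment> \<open>The left hand side is what \<open>(s + w * t^2)^2\<close> adds to
    \<open>s^2\<close>.\<close>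
  then have "t\<^sup>2 * (2 * w * s + w\<^sup>2 * t\<^sup>2) \<le> t\<^sup>2" by (simp add: mult_left_le)
  then have "(s + w * t\<^sup>2)\<^sup>2 \<le> s\<^sup>2 + t\<^sup>2"
    by (simp add: power2_eq_square algebra_simps)
  also have "s\<^sup>2 + t\<^sup>2 = (al\<^sup>2 + be\<^sup>2) * (x\<^sup>2 + y\<^sup>2)"
    by (simp add: s_def t_def power2_eq_square algebra_simps)
  also have "\<dots> \<le> x\<^sup>2 + y\<^sup>2" using mult_right_mono[OF assms(4), of "x\<^sup>2 +
      y\<^sup>2"] by simp
  finally show ?thesis unfolding norm2_def s_def t_def by (rule real_le_rsqrt)
qed
lemma norm2_upper: "x\<^sup>2 + y\<^sup>2 \<le> h\<^sup>2 \<Longrightarrow> 0 \<le> h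
    \<Longrightarrow> norm2 x y \<le> h"
  unfolding norm2_def by (rule real_le_lsqrt) auto
text \<open>The unit vectors are the directions of the edges at the approximate critical point, rounded
  towards zero so that their norm is at most 1, and the sum of squares is a rounded Cholesky
  decomposition of the Hessian.  The linear terms nearly cancel, because the point is nearly
      critical.\<close>

lemma length_growth:
  fixes p1 p2 p3 p4 p5 p6 :: real
  assumes "\<bar>p1\<bar> \<le> 1 / 10000" and "\<bar>p2\<bar> \<le> 1 / 10000" and "\<bar>p3\<bar>
      \<le> 1 / 10000" and "\<bar>p4\<bar> \<le> 1 / 10000" and "\<bar>p5\<bar> \<le> 1 / 10000" and
      "\<bar>p6\<bar> \<le> 1 / 10000"
  shows "
     norm2 (- 974021 / 1000000) (- 88171 / 100000) +
     norm2 (2225979 / 1000000) (- 88171 / 100000) +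
     norm2 (- 951227 / 1000000) (- 1) +
     norm2 (22794 / 1000000) (- 11829 / 100000) +
     norm2 (- 572946 / 1000000) (- 899242 / 1000000) +
     norm2 (- 572946 / 1000000) (1100758 / 1000000) +
     norm2 (- 401075 / 1000000) (17532 / 1000000) +
     norm2 (- 16 / 10) (- 890323 / 1000000) +
     norm2 (- 625979 / 1000000) ((- 8613 / 1000000))
     + 7 / 50 * p1\<^sup>2 + 7 / 50 * p2\<^sup>2 + 7 / 50 * p3\<^sup>2 + 7 / 50 * p4\<^sup>2 +
         7 / 50 * p5\<^sup>2 + 7 / 50 * p6\<^sup>2 - 1 / 1000000000
   \<le>
     norm2 ((- 974021 / 1000000) + p1) ((- 88171 / 100000) + p2) +
     norm2 ((2225979 / 1000000) + p1) ((- 88171 / 100000) + p2) +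
     norm2 ((- 951227 / 1000000) + p3) (- 1) +
     norm2 ((22794 / 1000000) - p1 + p3) ((- 11829 / 100000) - p2) +
     norm2 ((- 572946 / 1000000) + p4) ((- 899242 / 1000000) + p5) +
     norm2 ((- 572946 / 1000000) + p4) ((1100758 / 1000000) + p5) +
     norm2 ((- 401075 / 1000000) + p1 - p4) ((17532 / 1000000) + p2 - p5) +
     norm2 (- 16 / 10) ((- 890323 / 1000000) + p6) +
     norm2 ((- 625979 / 1000000) - p1) ((- 8613 / 1000000) - p2 + p6)
     + p3 / 2 + p6 / 2"
proof -
  have bounds: "p1 \<le> 1 / 10000" "- p1 \<le> 1 / 10000" "p2 \<le> 1 / 10000" "- p2 \<le>
      1 / 10000" "p3 \<le> 1 / 10000" "- p3 \<le> 1 / 10000" "p4 \<le> 1 / 10000" "- p4 \<le>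
      1 / 10000" "p5 \<le> 1 / 10000" "- p5 \<le> 1 / 10000" "p6 \<le> 1 / 10000" "- p6 \<le>
      1 / 10000"
    using assms by linarith+
  \<comment> \<open>\<open>s0\<close> is the component along the rounded direction of the edge,
    \<open>t0\<close> the one across it. \<open>S\<close> and \<open>T\<close> are bounds for the
    two on the whole cube, and the weight of the square is \<open>1 / (2 * S)\<close> rounded down.
    The next eight blocks do the same for the other norms.\<close>
  define s0 where "s0 = (- 741364253 / 1000000000) * ((- 974021 / 1000000) + p1) + (-
      6711028566 / 10000000000) * ((- 88171 / 100000) + p2)"
  define t0 where "t0 = (- 741364253 / 1000000000) * ((- 88171 / 100000) + p2) - (-
      6711028566 / 10000000000) * ((- 974021 / 1000000) + p1)"
  have n0: "s0 + (3805 / 10000) * t0\<^sup>2 \<le> norm2 ((- 974021 / 1000000) + p1) ((-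
      88171 / 100000) + p2)"
    unfolding s0_def t0_def
    by (rule norm2_lower[where S = "1313964 / 1000000" and T = "142 / 1000000"], use bounds in argo,
        rule abs_leI,
        use bounds in argo, use bounds in argo) (simp_all add: power2_eq_square)
  \<comment> \<open>The norms at the centre enter with the opposite sign and so need upper
    bounds.\<close>
  have u0: "norm2 (- 974021 / 1000000) (- 88171 / 100000) \<le> 131382245092 / 100000000000"
    by (rule norm2_upper) (simp_all add: power2_eq_square)
  define s1 where "s1 = (929721785 / 1000000000) * ((2225979 / 1000000) + p1) + (-
      3682626813 / 10000000000) * ((- 88171 / 100000) + p2)"
  define t1 where "t1 = (929721785 / 1000000000) * ((- 88171 / 100000) + p2) - (-
      3682626813 / 10000000000) * ((2225979 / 1000000) + p1)"
  have n1: "s1 + (2088 / 10000) * t1\<^sup>2 \<le> norm2 ((2225979 / 1000000) + p1) ((-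
      88171 / 100000) + p2)"
    unfolding s1_def t1_def
    by (rule norm2_lower[where S = "2394372 / 1000000" and T = "13 / 100000"], use bounds in argo,
        rule abs_leI,
        use bounds in argo, use bounds in argo) (simp_all add: power2_eq_square)
  have u1: "norm2 (2225979 / 1000000) (- 88171 / 100000) \<le> 239424205806 / 100000000000"
    by (rule norm2_upper) (simp_all add: power2_eq_square)
  define s2 where "s2 = (- 6892166142 / 10000000000) * ((- 951227 / 1000000) + p3) + (-
      7245553524 / 10000000000) * (- 1)"
  define t2 where "t2 = (- 6892166142 / 10000000000) * (- 1) - (- 7245553524 / 10000000000) * ((-
      951227 / 1000000) + p3)"
  have n2: "s2 + (3622 / 10000) * t2\<^sup>2 \<le> norm2 ((- 951227 / 1000000) + p3) (- 1)"
    unfolding s2_def t2_def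
    by (rule norm2_lower[where S = "1380226 / 1000000" and T = "73 / 1000000"], use bounds in argo,
        rule abs_leI,
        use bounds in argo, use bounds in argo) (simp_all add: power2_eq_square)
  have u2: "norm2 (- 951227 / 1000000) (- 1) \<le> 138015680469 / 100000000000"
    by (rule norm2_upper) (simp_all add: power2_eq_square)
  define s3 where "s3 = (1892149966 / 10000000000) * ((22794 / 1000000) - p1 + p3) + (-
      9819356827 / 10000000000) * ((- 11829 / 100000) - p2)"
  define t3 where "t3 = (1892149966 / 10000000000) * ((- 11829 / 100000) - p2) - (-
      9819356827 / 10000000000) * ((22794 / 1000000) - p1 + p3)"
  have n3: "s3 + (41458 / 10000) * t3\<^sup>2 \<le> norm2 ((22794 / 1000000) - p1 + p3) ((-
      11829 / 100000) - p2)"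
    unfolding s3_def t3_def
    by (rule norm2_lower[where S = "120603 / 1000000" and T = "216 / 1000000"], use bounds in argo,
        rule abs_leI,
        use bounds in argo, use bounds in argo) (simp_all add: power2_eq_square)
  have u3: "norm2 (22794 / 1000000) (- 11829 / 100000) \<le> 12046613855 / 100000000000"
    by (rule norm2_upper) (simp_all add: power2_eq_square)
  define s4 where "s4 = (- 537343413 / 1000000000) * ((- 572946 / 1000000) + p4) + (-
      8433635375 / 10000000000) * ((- 899242 / 1000000) + p5)"
  define t4 where "t4 = (- 537343413 / 1000000000) * ((- 899242 / 1000000) + p5) - (-
      8433635375 / 10000000000) * ((- 572946 / 1000000) + p4)"
  have n4: "s4 + (4688 / 10000) * t4\<^sup>2 \<le> norm2 ((- 572946 / 1000000) + p4) ((-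
      899242 / 1000000) + p5)"
    unfolding s4_def t4_def
    by (rule norm2_lower[where S = "1066395 / 1000000" and T = "139 / 1000000"], use bounds in argo,
        rule abs_leI,
        use bounds in argo, use bounds in argo) (simp_all add: power2_eq_square)
  have u4: "norm2 (- 572946 / 1000000) (- 899242 / 1000000) \<le> 106625667336 / 100000000000"
    by (rule norm2_upper) (simp_all add: power2_eq_square)
  define s5 where "s5 = (- 4617027437 / 10000000000) * ((- 572946 / 1000000) + p4) +
      (8870347097 / 10000000000) * ((1100758 / 1000000) + p5)"
  define t5 where "t5 = (- 4617027437 / 10000000000) * ((1100758 / 1000000) + p5) -
      (8870347097 / 10000000000) * ((- 572946 / 1000000) + p4)"
  have n5: "s5 + (4028 / 10000) * t5\<^sup>2 \<le> norm2 ((- 572946 / 1000000) + p4)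
      ((1100758 / 1000000) + p5)"
    unfolding s5_def t5_def
    by (rule norm2_lower[where S = "1241077 / 1000000" and T = "135 / 1000000"], use bounds in argo,
        rule abs_leI,
        use bounds in argo, use bounds in argo) (simp_all add: power2_eq_square)
  have u5: "norm2 (- 572946 / 1000000) (1100758 / 1000000) \<le> 124094129333 / 100000000000"
    by (rule norm2_upper) (simp_all add: power2_eq_square)
  define s6 where "s6 = (- 9990459746 / 10000000000) * ((- 401075 / 1000000) + p1 - p4) +
      (436708197 / 10000000000) * ((17532 / 1000000) + p2 - p5)"
  define t6 where "t6 = (- 9990459746 / 10000000000) * ((17532 / 1000000) + p2 - p5) -
      (436708197 / 10000000000) * ((- 401075 / 1000000) + p1 - p4)"
  have n6: "s6 + (12448 / 10000) * t6\<^sup>2 \<le> norm2 ((- 401075 / 1000000) + p1 - p4)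
      ((17532 / 1000000) + p2 - p5)"
    unfolding s6_def t6_def
    by (rule norm2_lower[where S = "401667 / 1000000" and T = "209 / 1000000"], use bounds in argo,
        rule abs_leI,
        use bounds in argo, use bounds in argo) (simp_all add: power2_eq_square)
  have u6: "norm2 (- 401075 / 1000000) (17532 / 1000000) \<le> 40145800111 / 100000000000"
    by (rule norm2_upper) (simp_all add: power2_eq_square)
  define s7 where "s7 = (- 8738245696 / 10000000000) * (- 16 / 10) + (- 4862413202 / 10000000000) *
      ((- 890323 / 1000000) + p6)"
  define t7 where "t7 = (- 8738245696 / 10000000000) * ((- 890323 / 1000000) + p6) - (-
      4862413202 / 10000000000) * (- 16 / 10)"
  have n7: "s7 + (273 / 1000) * t7\<^sup>2 \<le> norm2 (- 16 / 10) ((- 890323 / 1000000) + p6)"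
    unfolding s7_def t7_def
    by (rule norm2_lower[where S = "183108 / 100000" and T = "88 / 1000000"], use bounds in argo,
        rule abs_leI,
        use bounds in argo, use bounds in argo) (simp_all add: power2_eq_square)
  have u7: "norm2 (- 16 / 10) (- 890323 / 1000000) \<le> 183103114238 / 100000000000"
    by (rule norm2_upper) (simp_all add: power2_eq_square)
  define s8 where "s8 = (- 9999053549 / 10000000000) * ((- 625979 / 1000000) - p1) + (-
      137579452 / 10000000000) * ((- 8613 / 1000000) - p2 + p6)"
  define t8 where "t8 = (- 9999053549 / 10000000000) * ((- 8613 / 1000000) - p2 + p6) - (-
      137579452 / 10000000000) * ((- 625979 / 1000000) - p1)"
  have n8: "s8 + (7985 / 10000) * t8\<^sup>2 \<le> norm2 ((- 625979 / 1000000) - p1) ((-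
      8613 / 1000000) - p2 + p6)"
    unfolding s8_def t8_def
    by (rule norm2_lower[where S = "626141 / 1000000" and T = "202 / 1000000"], use bounds in argo,
        rule abs_leI,
        use bounds in argo, use bounds in argo) (simp_all add: power2_eq_square)
  have u8: "norm2 (- 625979 / 1000000) (- 8613 / 1000000) \<le> 6260382514 / 10000000000"
    by (rule norm2_upper) (simp_all add: power2_eq_square)
  \<comment> \<open>Expanding the lower bounds into monomials makes the final comparison linear in
    these monomials.\<close>
  have e0: "s0 + (3805 / 10000) * t0\<^sup>2 =
      131382245076409900000022359910284178 / 100000000000000000000000000000000000 -
      74136425298761969220834475436 / 100000000000000000000000000000 * p1 -
      6711028566136764693334350662 / 10000000000000000000000000000 * p2 +
      17136922629400680223458 / 100000000000000000000000 * (p1 * p1) -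
      3786215993247325161678 / 10000000000000000000000 * (p1 * p2) +
      2091307736157873674245 / 10000000000000000000000 * (p2 * p2)"
    unfolding s0_def t0_def by algebra
  have e1: "s1 + (2088 / 10000) * t1\<^sup>2 =
      2394242057981538000000005522209454952 / 1000000000000000000000000000000000000 +
      929721785000790877811492342576 / 1000000000000000000000000000000 * p1 -
      3682626812980033373785747368 / 10000000000000000000000000000 * p2 +
      28316913629109809191272 / 1000000000000000000000000 * (p1 * p1) +
      1429786553012141975208 / 10000000000000000000000 * (p1 * p2) +
      18048308635874880378 / 100000000000000000000 * (p2 * p2)"
    unfolding s1_def t1_def by algebra
  have e2: "s2 + (3622 / 10000) * t2\<^sup>2 =
      1380156804675623400000002458275681888 / 1000000000000000000000000000000000000 -
      689216614198632614154009895488 / 1000000000000000000000000000000 * p3 +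
      190147922138057020882272 / 1000000000000000000000000 * (p3 * p3)"
    unfolding s2_def t2_def by algebra
  have e3: "s3 + (41458 / 10000) * t3\<^sup>2 =
      120466138539083400000055226367797832 / 1000000000000000000000000000000000000 -
      189214996629716006995783582936 / 1000000000000000000000000000000 * p1 +
      981935682694273846788811917712 / 1000000000000000000000000000000 * p2 +
      189214996629716006995783582936 / 1000000000000000000000000000000 * p3 +
      3997370762305157615720482 / 1000000000000000000000000 * (p1 * p1) +
      1540554047529389791103912 / 1000000000000000000000000 * (p1 * p2) -
      7994741524610315231440964 / 1000000000000000000000000 * (p1 * p3) +
      148429237271361728325448 / 1000000000000000000000000 * (p2 * p2) -
      1540554047529389791103912 / 1000000000000000000000000 * (p2 * p3) +
      3997370762305157615720482 / 1000000000000000000000000 * (p3 * p3)"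
    unfolding s3_def t3_def by algebra
  have e4: "s4 + (4688 / 10000) * t4\<^sup>2 =
      10662566732932730000006235667446608 / 10000000000000000000000000000000000 -
      53734341297116100706619004 / 100000000000000000000000000 * p4 -
      8433635375183745706347143648 / 10000000000000000000000000000 * p5 +
      33343965203306011925 / 100000000000000000000 * (p4 * p4) -
      42489766912166726988 / 100000000000000000000 * (p4 * p5) +
      1353603479102162411472 / 10000000000000000000000 * (p5 * p5)"
    unfolding s4_def t4_def by algebra
  have e5: "s5 + (4028 / 10000) * t5\<^sup>2 =
      1240941293171892800000467051217119168 / 1000000000000000000000000000000000000 -
      461702743724333108622933010912 / 1000000000000000000000000000000 * p4 +
      887034709687334584666074764448 / 1000000000000000000000000000000 * p5 +
      316935356098420486803452 / 1000000000000000000000000 * (p4 * p4) +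
      329930546992161891933784 / 1000000000000000000000000 * (p4 * p5) +
      85864643801955457967132 / 1000000000000000000000000 * (p5 * p5)"
    unfolding s5_def t5_def by algebra
  have e6: "s6 + (12448 / 10000) * t6\<^sup>2 =
      401458001073675400000299437628483232 / 1000000000000000000000000000000000000 -
      999045974598313740860895206336 / 1000000000000000000000000000000 * p1 +
      43670819738576111385770612352 / 1000000000000000000000000000000 * p2 +
      999045974598313740860895206336 / 1000000000000000000000000000000 * p4 -
      43670819738576111385770612352 / 1000000000000000000000000000000 * p5 +
      2374008486022381590432 / 1000000000000000000000000 * (p1 * p1) +
      108619148342979268301952 / 1000000000000000000000000 * (p1 * p2) -
      4748016972044763180864 / 1000000000000000000000000 * (p1 * p4) -
      108619148342979268301952 / 1000000000000000000000000 * (p1 * p5) +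
      1242425991336884594455168 / 1000000000000000000000000 * (p2 * p2) -
      108619148342979268301952 / 1000000000000000000000000 * (p2 * p4) -
      2484851982673769188910336 / 1000000000000000000000000 * (p2 * p5) +
      2374008486022381590432 / 1000000000000000000000000 * (p4 * p4) +
      108619148342979268301952 / 1000000000000000000000000 * (p4 * p5) +
      1242425991336884594455168 / 1000000000000000000000000 * (p5 * p5)"
    unfolding s6_def t6_def by algebra
  have e7: "s7 + (273 / 1000) * t7\<^sup>2 =
      183103114228442460000043721942863872 / 100000000000000000000000000000000000 -
      48624132018090651092220796928 / 100000000000000000000000000000 * p6 +
      20845444031319869165568 / 100000000000000000000000 * (p6 * p6)"
    unfolding s7_def t7_def by algebra
  have e8: "s8 + (7985 / 10000) * t8\<^sup>2 =
      626038251336954700001504223665135385 / 1000000000000000000000000000000000000 +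
      99990535489904637585260543524 / 100000000000000000000000000000 * p1 +
      1375794526930787102871816837 / 100000000000000000000000000000 * p2 -
      1375794526930787102871816837 / 100000000000000000000000000000 * p6 +
      15114092331677312744 / 100000000000000000000000 * (p1 * p1) -
      2196935899540750011356 / 100000000000000000000000 * (p1 * p2) +
      2196935899540750011356 / 100000000000000000000000 * (p1 * p6) +
      798348858928019420776985 / 1000000000000000000000000 * (p2 * p2) -
      159669771785603884155397 / 100000000000000000000000 * (p2 * p6) +
      798348858928019420776985 / 1000000000000000000000000 * (p6 * p6)"
    unfolding s8_def t8_def by algebra
  \<comment> \<open>The order of elimination is \<open>p4\<close>, \<open>p5\<close>,
    \<open>p3\<close>, \<open>p6\<close>, \<open>p1\<close>, \<open>p2\<close>. Within the quarter
    the outer and the axis hubs interact only with the inner hub, so eliminating the inner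
    coordinates last keeps the squares sparse.\<close>
  have f0: "499 / 1000 * ((- 5 / 1000) * p1 + (- 109 / 1000) * p2 + p4 + (14 / 1000) * p5)\<^sup>2 =
      12475 / 1000000000 * (p1 * p1) + 54391 / 100000000 * (p1 * p2) - 499 / 100000 * (p1 * p4) -
      6986 / 100000000 * (p1 * p5) + 5928619 / 1000000000 * (p2 * p2) - 108782 / 1000000 * (p2 * p4)
      - 1522948 / 1000000000 * (p2 * p5) + 499 / 1000 * (p4 * p4) + 13972 / 1000000 * (p4 * p5) +
      97804 / 1000000000 * (p5 * p5)"
    by algebra
  have f1: "131 / 100 * ((- 41 / 1000) * p1 + (- 948 / 1000) * p2 + p5)\<^sup>2 = 220211 / 100000000
      * (p1 * p1) + 10183416 / 100000000 * (p1 * p2) - 10742 / 100000 * (p1 * p5) +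
      117730224 / 100000000 * (p2 * p2) - 248376 / 100000 * (p2 * p5) + 131 / 100 * (p5 * p5)"
    by algebra
  have f2: "4034 / 1000 * ((- 991 / 1000) * p1 + (- 191 / 1000) * p2 + p3)\<^sup>2 =
      3961714754 / 1000000000 * (p1 * p1) + 1527119108 / 1000000000 * (p1 * p2) - 7995388 / 1000000
      * (p1 * p3) + 147164354 / 1000000000 * (p2 * p2) - 1540988 / 1000000 * (p2 * p3) + 4034 / 1000
      * (p3 * p3)"
    by algebra
  have f3: "853 / 1000 * ((13 / 1000) * p1 + (- 936 / 1000) * p2 + p6)\<^sup>2 = 144157 / 1000000000
      * (p1 * p1) - 20758608 / 1000000000 * (p1 * p2) + 22178 / 1000000 * (p1 * p6) +
      747309888 / 1000000000 * (p2 * p2) - 1596816 / 1000000 * (p2 * p6) + 853 / 1000 * (p6 * p6)"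
    by algebra
  have f4: "82 / 1000 * (p1 + (- 1336 / 1000) * p2)\<^sup>2 = 82 / 1000 * (p1 * p1) -
      219104 / 1000000 * (p1 * p2) + 146361472 / 1000000000 * (p2 * p2)"
    by algebra
  have f5: "201 / 1000 * (p2)\<^sup>2 = 201 / 1000 * (p2 * p2)"
    by algebra
  \<comment> \<open>The rounded decomposition leaves small mixed terms. Each is completed to the
    square of a sum or a difference, at a cost on the diagonal that is less than the surplus left
    there.\<close>
  have g0: "963161426721620322652 / 1000000000000000000000000 * (p1 + p2)\<^sup>2 =
      963161426721620322652 / 1000000000000000000000000 * (p1 * p1) +
      1926322853443240645304 / 1000000000000000000000000 * (p1 * p2) +
      963161426721620322652 / 1000000000000000000000000 * (p2 * p2)"
    by algebra
  have g1: "323237694842384279518 / 1000000000000000000000000 * (p1 + p3)\<^sup>2 =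
      323237694842384279518 / 1000000000000000000000000 * (p1 * p1) +
      646475389684768559036 / 1000000000000000000000000 * (p1 * p3) +
      323237694842384279518 / 1000000000000000000000000 * (p3 * p3)"
    by algebra
  have g2: "120991513977618409568 / 1000000000000000000000000 * (p1 + p4)\<^sup>2 =
      120991513977618409568 / 1000000000000000000000000 * (p1 * p1) +
      241983027955236819136 / 1000000000000000000000000 * (p1 * p4) +
      120991513977618409568 / 1000000000000000000000000 * (p4 * p4)"
    by algebra
  have g3: "564644171489634150976 / 1000000000000000000000000 * (p1 - p5)\<^sup>2 =
      564644171489634150976 / 1000000000000000000000000 * (p1 * p1) -
      1129288342979268301952 / 1000000000000000000000000 * (p1 * p5) +
      564644171489634150976 / 1000000000000000000000000 * (p5 * p5)"
    by algebra
  have g4: "10432050229624994322 / 100000000000000000000000 * (p1 - p6)\<^sup>2 =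
      10432050229624994322 / 100000000000000000000000 * (p1 * p1) -
      20864100459249988644 / 100000000000000000000000 * (p1 * p6) +
      10432050229624994322 / 100000000000000000000000 * (p6 * p6)"
    by algebra
  have g5: "216976235305104448044 / 1000000000000000000000000 * (p2 + p3)\<^sup>2 =
      216976235305104448044 / 1000000000000000000000000 * (p2 * p2) +
      433952470610208896088 / 1000000000000000000000000 * (p2 * p3) +
      216976235305104448044 / 1000000000000000000000000 * (p3 * p3)"
    by algebra
  have g6: "81425828510365849024 / 1000000000000000000000000 * (p2 + p4)\<^sup>2 =
      81425828510365849024 / 1000000000000000000000000 * (p2 * p2) +
      162851657020731698048 / 1000000000000000000000000 * (p2 * p4) +
      81425828510365849024 / 1000000000000000000000000 * (p4 * p4)"
    by algebra
  have g7: "215482663115405544832 / 1000000000000000000000000 * (p2 + p5)\<^sup>2 =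
      215482663115405544832 / 1000000000000000000000000 * (p2 * p2) +
      430965326230811089664 / 1000000000000000000000000 * (p2 * p5) +
      215482663115405544832 / 1000000000000000000000000 * (p5 * p5)"
    by algebra
  have g8: "59141071980579223015 / 1000000000000000000000000 * (p2 + p6)\<^sup>2 =
      59141071980579223015 / 1000000000000000000000000 * (p2 * p2) +
      11828214396115844603 / 100000000000000000000000 * (p2 * p6) +
      59141071980579223015 / 1000000000000000000000000 * (p6 * p6)"
    by algebra
  have g9: "159986893263054822132 / 1000000000000000000000000 * (p4 - p5)\<^sup>2 =
      159986893263054822132 / 1000000000000000000000000 * (p4 * p4) -
      319973786526109644264 / 1000000000000000000000000 * (p4 * p5) +
      159986893263054822132 / 1000000000000000000000000 * (p5 * p5)"
    by algebra
  \<comment> \<open>One hundredth of each square is set aside to absorb the remaining linear term,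
    about 10^(-6) in size. The constants that arise, together with the rounding of the norms, fit
    into the 10^(-9) granted in the statement.\<close>
  have k0: "1 / 100 * ((957842093906799537117092 / 10000000000000000000000000000) + p1)\<^sup>2 =
      917461476859762182949618575222884311786518536464 / 10000000000000000000000000000000000000000000000000000000000
      + 1915684187813599074234184 / 1000000000000000000000000000000 * p1 + 1 / 100 * (p1 * p1)"
    by algebra
  have k1: "1 / 100 * ((- 545104760988754354552283 / 10000000000000000000000000000) + p2)\<^sup>2 =
      297139200452607011251989437980261758085380512089 / 10000000000000000000000000000000000000000000000000000000000
      - 1090209521977508709104566 / 1000000000000000000000000000000 * p2 + 1 / 100 * (p2 * p2)"
    by algebra
  have k2: "1 / 100 * ((- 808784458303579113156276 / 10000000000000000000000000000) + p3)\<^sup>2 =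
      654132299993413901080598985861567027950798188176 / 10000000000000000000000000000000000000000000000000000000000
      - 1617568916607158226312552 / 1000000000000000000000000000000 * p3 + 1 / 100 * (p3 * p3)"
    by algebra
  have k3: "1 / 100 * ((- 91048590187414113922288 / 10000000000000000000000000000) + p4)\<^sup>2 =
      8289845775115681672571434045116344751703154944 / 10000000000000000000000000000000000000000000000000000000000
      - 182097180374828227844576 / 1000000000000000000000000000000 * p4 + 1 / 100 * (p4 * p4)"
    by algebra
  have k4: "1 / 100 * ((176215191951322794893648 / 10000000000000000000000000000) + p5)\<^sup>2 =
      31051793874441537914691074097797861223630747904 / 10000000000000000000000000000000000000000000000000000000000
      + 352430383902645589787296 / 1000000000000000000000000000000 * p5 + 1 / 100 * (p5 * p5)"
    by algebra
  have k5: "1 / 100 * ((367274892809024536931175 / 10000000000000000000000000000) + p6)\<^sup>2 =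
      134890846887880463508015320472902141486686880625 / 10000000000000000000000000000000000000000000000000000000000
      + 73454978561804907386235 / 100000000000000000000000000000 * p6 + 1 / 100 * (p6 * p6)"
    by algebra
  have q0: "p1\<^sup>2 = p1 * p1" by (rule power2_eq_square)
  have q1: "p2\<^sup>2 = p2 * p2" by (rule power2_eq_square)
  have q2: "p3\<^sup>2 = p3 * p3" by (rule power2_eq_square)
  have q3: "p4\<^sup>2 = p4 * p4" by (rule power2_eq_square)
  have q4: "p5\<^sup>2 = p5 * p5" by (rule power2_eq_square)
  have q5: "p6\<^sup>2 = p6 * p6" by (rule power2_eq_square)
  have sos: "0 \<le> 499 / 1000 * ((- 5 / 1000) * p1 + (- 109 / 1000) * p2 + p4 + (14 / 1000) *
      p5)\<^sup>2
     + 131 / 100 * ((- 41 / 1000) * p1 + (- 948 / 1000) * p2 + p5)\<^sup>2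
     + 4034 / 1000 * ((- 991 / 1000) * p1 + (- 191 / 1000) * p2 + p3)\<^sup>2
     + 853 / 1000 * ((13 / 1000) * p1 + (- 936 / 1000) * p2 + p6)\<^sup>2
     + 82 / 1000 * (p1 + (- 1336 / 1000) * p2)\<^sup>2
     + 201 / 1000 * (p2)\<^sup>2
     + 963161426721620322652 / 1000000000000000000000000 * (p1 + p2)\<^sup>2
     + 323237694842384279518 / 1000000000000000000000000 * (p1 + p3)\<^sup>2
     + 120991513977618409568 / 1000000000000000000000000 * (p1 + p4)\<^sup>2
     + 564644171489634150976 / 1000000000000000000000000 * (p1 - p5)\<^sup>2
     + 10432050229624994322 / 100000000000000000000000 * (p1 - p6)\<^sup>2
     + 216976235305104448044 / 1000000000000000000000000 * (p2 + p3)\<^sup>2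
     + 81425828510365849024 / 1000000000000000000000000 * (p2 + p4)\<^sup>2
     + 215482663115405544832 / 1000000000000000000000000 * (p2 + p5)\<^sup>2
     + 59141071980579223015 / 1000000000000000000000000 * (p2 + p6)\<^sup>2
     + 159986893263054822132 / 1000000000000000000000000 * (p4 - p5)\<^sup>2
     + 1432200328285874758272 / 1000000000000000000000000 * p1\<^sup>2
     + 2215187285168839374534 / 1000000000000000000000000 * p2\<^sup>2
     + 2978470513067147875192 / 1000000000000000000000000 * p3\<^sup>2
     + 338661238175194856316 / 100000000000000000000000 * p4\<^sup>2
     + 261306532118819905156 / 100000000000000000000000 * p5\<^sup>2
     + 363983766694128326643 / 100000000000000000000000 * p6\<^sup>2
     + 1 / 100 * ((957842093906799537117092 / 10000000000000000000000000000) + p1)\<^sup>2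
     + 1 / 100 * ((- 545104760988754354552283 / 10000000000000000000000000000) + p2)\<^sup>2
     + 1 / 100 * ((- 808784458303579113156276 / 10000000000000000000000000000) + p3)\<^sup>2
     + 1 / 100 * ((- 91048590187414113922288 / 10000000000000000000000000000) + p4)\<^sup>2
     + 1 / 100 * ((176215191951322794893648 / 10000000000000000000000000000) + p5)\<^sup>2
     + 1 / 100 * ((367274892809024536931175 / 10000000000000000000000000000) + p6)\<^sup>2
     +
         1162677536192962268020652742319470554715281979798 / 10000000000000000000000000000000000000000000000000000000000"
    by (intro add_nonneg_nonneg mult_nonneg_nonneg zero_le_power2) simp_all
  have "0 \<le> (s0 + (3805 / 10000) * t0\<^sup>2) + (s1 + (2088 / 10000) * t1\<^sup>2) + (s2 +
      (3622 / 10000) * t2\<^sup>2) + (s3 + (41458 / 10000) * t3\<^sup>2) + (s4 + (4688 / 10000) *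
      t4\<^sup>2) + (s5 + (4028 / 10000) * t5\<^sup>2) + (s6 + (12448 / 10000) * t6\<^sup>2) + (s7 +
      (273 / 1000) * t7\<^sup>2) + (s8 + (7985 / 10000) * t8\<^sup>2) + p3 / 2 + p6 / 2
     - (131382245092 / 100000000000 + 239424205806 / 100000000000 + 138015680469 / 100000000000 +
         12046613855 / 100000000000 + 106625667336 / 100000000000 + 124094129333 / 100000000000 +
         40145800111 / 100000000000 + 183103114238 / 100000000000 + 6260382514 / 10000000000) -
         (7 / 50 * p1\<^sup>2 + 7 / 50 * p2\<^sup>2 + 7 / 50 * p3\<^sup>2 + 7 / 50 * p4\<^sup>2 +
         7 / 50 * p5\<^sup>2 + 7 / 50 * p6\<^sup>2) + 1 / 1000000000"
    using sos unfolding e0 e1 e2 e3 e4 e5 e6 e7 e8 f0 f1 f2 f3 f4 f5 g0 g1 g2 g3 g4 g5 g6 g7 g8 g9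
        k0 k1 k2 k3 k4 k5 q0 q1 q2 q3 q4 q5 by linarith
  then show ?thesis
    using n0 u0 n1 u1 n2 u2 n3 u3 n4 u4 n5 u5 n6 u6 n7 u7 n8 u8 by linarith
qed


text \<open>A quarter of the total length of the symmetric arrangement. The nine norms belong to one
  quadrant; the segments on the axes have lengths \<open>2 * c\<close> and \<open>2 * e\<close>,
  whence the last two terms.\<close>

definition net_length :: "real \<Rightarrow> real \<Rightarrow> real \<Rightarrow> real
    \<Rightarrow> real \<Rightarrow> real \<Rightarrow> real" where
  "net_length b1 b2 c d1 d2 e =
     norm2 (b1 - 8 / 5) (b2 - 1) + norm2 (b1 + 8 / 5) (b2 - 1) + norm2 (c - 8 / 5) (- 1) +
     norm2 (c - b1) (- b2) + norm2 (d1 - 8 / 5) (d2 - 1) + norm2 (d1 - 8 / 5) (d2 + 1) +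
     norm2 (b1 - d1) (b2 - d2) + norm2 (- 8 / 5) (e - 1) + norm2 (- b1) (e - b2) + c / 2 + e / 2"

lemma net_length_growth:
  assumes "\<bar>b1 - 625979 / 1000000\<bar> \<le> 1 / 10000" "\<bar>b2 - 11829 / 100000\<bar> \<le>
      1 / 10000"
    "\<bar>c - 648773 / 1000000\<bar> \<le> 1 / 10000" "\<bar>d1 - 1027054 / 1000000\<bar> \<le>
        1 / 10000"
    "\<bar>d2 - 100758 / 1000000\<bar> \<le> 1 / 10000" "\<bar>e - 109677 / 1000000\<bar> \<le>
        1 / 10000"
  shows "net_length (625979 / 1000000) (11829 / 100000) (648773 / 1000000) (1027054 / 1000000)
      (100758 / 1000000) (109677 / 1000000)
    + (7 / 50 * (b1 - 625979 / 1000000)\<^sup>2 + 7 / 50 * (b2 - 11829 / 100000)\<^sup>2 + 7 / 50 *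
        (c - 648773 / 1000000)\<^sup>2 + 7 / 50 * (d1 - 1027054 / 1000000)\<^sup>2 + 7 / 50 * (d2 -
        100758 / 1000000)\<^sup>2 + 7 / 50 * (e - 109677 / 1000000)\<^sup>2)
    - 1 / 1000000000 \<le> net_length b1 b2 c d1 d2 e"
proof -
  have eqs: "norm2 ((- 974021 / 1000000) + (b1 - 625979 / 1000000)) ((- 88171 / 100000) + (b2 -
      11829 / 100000)) = norm2 (b1 - 8 / 5) (b2 - 1)"
    "norm2 (- 974021 / 1000000) (- 88171 / 100000) = norm2 (625979 / 1000000 - 8 / 5)
        (11829 / 100000 - 1)"
    "norm2 ((2225979 / 1000000) + (b1 - 625979 / 1000000)) ((- 88171 / 100000) + (b2 -
        11829 / 100000)) = norm2 (b1 + 8 / 5) (b2 - 1)"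
    "norm2 (2225979 / 1000000) (- 88171 / 100000) = norm2 (625979 / 1000000 + 8 / 5) (11829 / 100000
        - 1)"
    "norm2 ((- 951227 / 1000000) + (c - 648773 / 1000000)) (- 1) = norm2 (c - 8 / 5) (- 1)"
    "norm2 (- 951227 / 1000000) (- 1) = norm2 (648773 / 1000000 - 8 / 5) (- 1)"
    "norm2 ((22794 / 1000000) - (b1 - 625979 / 1000000) + (c - 648773 / 1000000)) ((-
        11829 / 100000) - (b2 - 11829 / 100000)) = norm2 (c - b1) (- b2)"
    "norm2 (22794 / 1000000) (- 11829 / 100000) = norm2 (648773 / 1000000 - 625979 / 1000000) (-
        (11829 / 100000))"
    "norm2 ((- 572946 / 1000000) + (d1 - 1027054 / 1000000)) ((- 899242 / 1000000) + (d2 -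
        100758 / 1000000)) = norm2 (d1 - 8 / 5) (d2 - 1)"
    "norm2 (- 572946 / 1000000) (- 899242 / 1000000) = norm2 (1027054 / 1000000 - 8 / 5)
        (100758 / 1000000 - 1)"
    "norm2 ((- 572946 / 1000000) + (d1 - 1027054 / 1000000)) ((1100758 / 1000000) + (d2 -
        100758 / 1000000)) = norm2 (d1 - 8 / 5) (d2 + 1)"
    "norm2 (- 572946 / 1000000) (1100758 / 1000000) = norm2 (1027054 / 1000000 - 8 / 5)
        (100758 / 1000000 + 1)"
    "norm2 ((- 401075 / 1000000) + (b1 - 625979 / 1000000) - (d1 - 1027054 / 1000000))
        ((17532 / 1000000) + (b2 - 11829 / 100000) - (d2 - 100758 / 1000000)) = norm2 (b1 - d1) (b2
        - d2)"
    "norm2 (- 401075 / 1000000) (17532 / 1000000) = norm2 (625979 / 1000000 - 1027054 / 1000000)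
        (11829 / 100000 - 100758 / 1000000)"
    "norm2 (- 16 / 10) ((- 890323 / 1000000) + (e - 109677 / 1000000)) = norm2 (- 8 / 5) (e - 1)"
    "norm2 (- 16 / 10) (- 890323 / 1000000) = norm2 (- 8 / 5) (109677 / 1000000 - 1)"
    "norm2 ((- 625979 / 1000000) - (b1 - 625979 / 1000000)) ((- 8613 / 1000000) - (b2 -
        11829 / 100000) + (e - 109677 / 1000000)) = norm2 (- b1) (e - b2)"
    "norm2 (- 625979 / 1000000) (- 8613 / 1000000) = norm2 (- (625979 / 1000000)) (109677 / 1000000
        - 11829 / 100000)"
    by (simp_all add: add.commute)
  show ?thesis
    using length_growth[OF assms] unfolding eqs net_length_def diff_divide_distrib by linarith
qed

section \<open>Derivatives and the interior minimum\<close>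

text \<open>\<open>D\<close> is fixed by an equation in the last premise, as in
  \<open>derivative_eq_intros\<close>, so the rule applies with a yet unknown derivative and
  \<open>refl\<close> then determines it.\<close>

lemma norm2_deriv:
  assumes "(f has_real_derivative f') (at t)" "(g has_real_derivative g') (at t)"
    and "f t \<noteq> 0 \<or> g t \<noteq> 0" "(f' * f t + g' * g t) / norm2 (f t) (g t) = D"
  shows "((\<lambda>t. norm2 (f t) (g t)) has_real_derivative D) (at t)"
proof -
  have pos: "(f t)\<^sup>2 + (g t)\<^sup>2 > 0" using assms(3) sum_power2_gt_zero_iff by blast
  have d: "((\<lambda>t. (f t)\<^sup>2 + (g t)\<^sup>2) has_real_derivative 2 * (f' * f t + g' * g
      t)) (at t)"
    by (rule derivative_eq_intros assms(1,2) refl)+ simp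
  have "((\<lambda>t. sqrt ((f t)\<^sup>2 + (g t)\<^sup>2)) has_real_derivative
      inverse (sqrt ((f t)\<^sup>2 + (g t)\<^sup>2)) / 2 * (2 * (f' * f t + g' * g t))) (at t)"
    by (rule DERIV_chain2[OF DERIV_real_sqrt[OF pos] d])
  then show ?thesis
    unfolding norm2_def assms(4)[symmetric] by (rule DERIV_cong) (unfold divide_inverse, algebra)
qed

lemma continuous_on_norm2 [continuous_intros]:
  "continuous_on S f \<Longrightarrow> continuous_on S g \<Longrightarrow> continuous_on S
      (\<lambda>x. norm2 (f x) (g x))"
  unfolding norm2_def by (intro continuous_intros)

lemma interior_min_deriv_zero:
  fixes f :: "real \<Rightarrow> real"
  assumes "\<And>t. \<bar>t - m\<bar> \<le> r \<Longrightarrow> f x \<le> f t" "\<bar>x - m\<bar> <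
      r" "(f has_real_derivative l) (at x)"
  shows "l = 0"
  using assms(3)
proof (rule DERIV_local_min)
  show "0 < r - \<bar>x - m\<bar>" using assms(2) by simp
  show "\<forall>y. \<bar>x - y\<bar> < r - \<bar>x - m\<bar> \<longrightarrow> f x \<le> f y" using
      assms(1) by auto
qed

lemma critical_point:
  obtains b1 b2 c d1 d2 e :: real where
    "\<bar>b1 - 625979 / 1000000\<bar> \<le> 1 / 10000" "\<bar>b2 - 11829 / 100000\<bar> \<le> 1 / 10000"
    "\<bar>c - 648773 / 1000000\<bar> \<le> 1 / 10000" "\<bar>d1 - 1027054 / 1000000\<bar> \<le>
        1 / 10000"
    "\<bar>d2 - 100758 / 1000000\<bar> \<le> 1 / 10000" "\<bar>e - 109677 / 1000000\<bar> \<le>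
        1 / 10000"
    "(b1 - 8 / 5) / norm2 (b1 - 8 / 5) (b2 - 1) + (b1 + 8 / 5) / norm2 (b1 + 8 / 5) (b2 - 1)
      + (b1 - c) / norm2 (c - b1) (- b2) + (b1 - d1) / norm2 (b1 - d1) (b2 - d2)
      + b1 / norm2 (- b1) (e - b2) = 0"
    "(b2 - 1) / norm2 (b1 - 8 / 5) (b2 - 1) + (b2 - 1) / norm2 (b1 + 8 / 5) (b2 - 1)
      + b2 / norm2 (c - b1) (- b2) + (b2 - d2) / norm2 (b1 - d1) (b2 - d2)
      + (b2 - e) / norm2 (- b1) (e - b2) = 0"
    "(c - 8 / 5) / norm2 (c - 8 / 5) (- 1) + (c - b1) / norm2 (c - b1) (- b2) + 1 / 2 = 0"
    "(d1 - 8 / 5) / norm2 (d1 - 8 / 5) (d2 - 1) + (d1 - 8 / 5) / norm2 (d1 - 8 / 5) (d2 + 1)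
      + (d1 - b1) / norm2 (b1 - d1) (b2 - d2) = 0"
    "(d2 - 1) / norm2 (d1 - 8 / 5) (d2 - 1) + (d2 + 1) / norm2 (d1 - 8 / 5) (d2 + 1)
      + (d2 - b2) / norm2 (b1 - d1) (b2 - d2) = 0"
    "(e - 1) / norm2 (- 8 / 5) (e - 1) + (e - b2) / norm2 (- b1) (e - b2) + 1 / 2 = 0"
proof -
  define I :: "real \<Rightarrow> real set" where "I m = {m - 1 / 10000..m + 1 / 10000}" for m
  have I: "t \<in> I m \<longleftrightarrow> \<bar>t - m\<bar> \<le> 1 / 10000" for t m
    unfolding I_def atLeastAtMost_iff abs_le_iff by linarith
  let ?m1 = "625979 / 1000000" and ?m2 = "11829 / 100000" and ?m3 = "648773 / 1000000"
    and ?m4 = "1027054 / 1000000" and ?m5 = "100758 / 1000000" and ?m6 = "109677 / 1000000"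
  define K where "K = I ?m1 \<times> I ?m2 \<times> I ?m3 \<times> I ?m4 \<times> I ?m5 \<times> I ?m6"
  define F where "F p = net_length (fst p) (fst (snd p)) (fst (snd (snd p)))
    (fst (snd (snd (snd p)))) (fst (snd (snd (snd (snd p))))) (snd (snd (snd (snd (snd p)))))" for p
  have "compact K" unfolding K_def I_def by (intro compact_Times compact_Icc)
  moreover have "K \<noteq> {}" unfolding K_def I_def by simp
  moreover have "continuous_on K F" unfolding F_def net_length_def by (intro continuous_intros) auto
  ultimately have "\<exists>p\<in>K. \<forall>q\<in>K. F p \<le> F q" by (rule continuous_attains_inf)
  then obtain p where "p \<in> K" and p_min: "\<forall>q\<in>K. F p \<le> F q" by (elim bexE)
  obtain b1 b2 c d1 d2 e where p: "p = (b1, b2, c, d1, d2, e)" by (cases p rule: prod_cases6)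
  have mem: "\<bar>b1 - ?m1\<bar> \<le> 1 / 10000" "\<bar>b2 - ?m2\<bar> \<le> 1 / 10000" "\<bar>c -
      ?m3\<bar> \<le> 1 / 10000"
    "\<bar>d1 - ?m4\<bar> \<le> 1 / 10000" "\<bar>d2 - ?m5\<bar> \<le> 1 / 10000" "\<bar>e -
        ?m6\<bar> \<le> 1 / 10000"
    using \<open>p \<in> K\<close> unfolding p K_def mem_Times_iff fst_conv snd_conv I by blast+
  have min: "net_length b1 b2 c d1 d2 e \<le> net_length x1 x2 x3 x4 x5 x6"
    if "\<bar>x1 - ?m1\<bar> \<le> 1 / 10000" "\<bar>x2 - ?m2\<bar> \<le> 1 / 10000" "\<bar>x3 -
        ?m3\<bar> \<le> 1 / 10000"
      "\<bar>x4 - ?m4\<bar> \<le> 1 / 10000" "\<bar>x5 - ?m5\<bar> \<le> 1 / 10000" "\<bar>x6 -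
          ?m6\<bar> \<le> 1 / 10000"
    for x1 x2 x3 x4 x5 x6
    using bspec[OF p_min, of "(x1, x2, x3, x4, x5, x6)"] that
    unfolding p K_def F_def mem_Times_iff fst_conv snd_conv I by blast
  \<comment> \<open>Comparison with the centre bounds \<open>7 / 50\<close> times the squared
    distance by 10^(-9). As this is less than \<open>7 / 50\<close> times 10^(-8), the minimum is
    less than 10^(-4) away from the centre and hence off the boundary of the cube.\<close>
  have "net_length b1 b2 c d1 d2 e \<le> net_length ?m1 ?m2 ?m3 ?m4 ?m5 ?m6"
    by (rule min) auto
  then have sq: "(b1 - ?m1)\<^sup>2 + (b2 - ?m2)\<^sup>2 + (c - ?m3)\<^sup>2 + (d1 - ?m4)\<^sup>2 +
      (d2 - ?m5)\<^sup>2
      + (e - ?m6)\<^sup>2 < (1 / 10000)\<^sup>2"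
    using net_length_growth[OF mem] unfolding power2_eq_square[of "1 / 10000"] by simp
  have strict: "\<bar>t\<bar> < 1 / 10000" if "t\<^sup>2 < (1 / 10000)\<^sup>2" for t :: real
    using that by (rule power2_less_imp_less[of "\<bar>t\<bar>", unfolded power2_abs]) simp
  note nn = zero_le_power2[of "b1 - ?m1"] zero_le_power2[of "b2 - ?m2"] zero_le_power2[of "c - ?m3"]
    zero_le_power2[of "d1 - ?m4"] zero_le_power2[of "d2 - ?m5"] zero_le_power2[of "e - ?m6"]
  have lt: "\<bar>b1 - ?m1\<bar> < 1 / 10000" "\<bar>b2 - ?m2\<bar> < 1 / 10000" "\<bar>c -
      ?m3\<bar> < 1 / 10000"
    "\<bar>d1 - ?m4\<bar> < 1 / 10000" "\<bar>d2 - ?m5\<bar> < 1 / 10000" "\<bar>e - ?m6\<bar> <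
        1 / 10000"
    by (rule strict; use sq nn in linarith)+
  \<comment> \<open>A norm is differentiable only off the origin; here one component of each edge
    vector is seen to be nonzero.\<close>
  have nz: "b1 - 8 / 5 \<noteq> 0" "b1 + 8 / 5 \<noteq> 0" "- b2 \<noteq> 0" "d1 - 8 / 5 \<noteq> 0"
      "b1 - d1 \<noteq> 0" "- b1 \<noteq> 0"
    "- 1 \<noteq> (0::real)" "- 8 / 5 \<noteq> (0::real)" "2 \<noteq> (0::real)"
    using mem unfolding abs_le_iff by linarith+
  have 1: "(b1 - 8 / 5) / norm2 (b1 - 8 / 5) (b2 - 1) + (b1 + 8 / 5) / norm2 (b1 + 8 / 5) (b2 - 1)
      + (b1 - c) / norm2 (c - b1) (- b2) + (b1 - d1) / norm2 (b1 - d1) (b2 - d2)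
      + b1 / norm2 (- b1) (e - b2) = 0"
    by (rule interior_min_deriv_zero[OF _ lt(1), of "\<lambda>t. net_length t b2 c d1 d2 e"], rule min,
        (assumption | rule mem)+, unfold net_length_def,
        (rule derivative_eq_intros norm2_deriv refl nz | rule disjI1, rule nz | rule disjI2, rule nz)+)
      simp
  have 2: "(b2 - 1) / norm2 (b1 - 8 / 5) (b2 - 1) + (b2 - 1) / norm2 (b1 + 8 / 5) (b2 - 1)
      + b2 / norm2 (c - b1) (- b2) + (b2 - d2) / norm2 (b1 - d1) (b2 - d2)
      + (b2 - e) / norm2 (- b1) (e - b2) = 0"
    by (rule interior_min_deriv_zero[OF _ lt(2), of "\<lambda>t. net_length b1 t c d1 d2 e"], rule min,
        (assumption | rule mem)+, unfold net_length_def,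
        (rule derivative_eq_intros norm2_deriv refl nz | rule disjI1, rule nz | rule disjI2, rule nz)+)
      simp
  have 3: "(c - 8 / 5) / norm2 (c - 8 / 5) (- 1) + (c - b1) / norm2 (c - b1) (- b2) + 1 / 2 = 0"
    by (rule interior_min_deriv_zero[OF _ lt(3), of "\<lambda>t. net_length b1 b2 t d1 d2 e"], rule min,
        (assumption | rule mem)+, unfold net_length_def,
        (rule derivative_eq_intros norm2_deriv refl nz | rule disjI1, rule nz | rule disjI2, rule nz)+)
      simp
  have 4: "(d1 - 8 / 5) / norm2 (d1 - 8 / 5) (d2 - 1) + (d1 - 8 / 5) / norm2 (d1 - 8 / 5) (d2 + 1)
      + (d1 - b1) / norm2 (b1 - d1) (b2 - d2) = 0"
    by (rule interior_min_deriv_zero[OF _ lt(4), of "\<lambda>t. net_length b1 b2 c t d2 e"], rule min,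
        (assumption | rule mem)+, unfold net_length_def,
        (rule derivative_eq_intros norm2_deriv refl nz | rule disjI1, rule nz | rule disjI2, rule nz)+)
      simp
  have 5: "(d2 - 1) / norm2 (d1 - 8 / 5) (d2 - 1) + (d2 + 1) / norm2 (d1 - 8 / 5) (d2 + 1)
      + (d2 - b2) / norm2 (b1 - d1) (b2 - d2) = 0"
    by (rule interior_min_deriv_zero[OF _ lt(5), of "\<lambda>t. net_length b1 b2 c d1 t e"], rule min,
        (assumption | rule mem)+, unfold net_length_def,
        (rule derivative_eq_intros norm2_deriv refl nz | rule disjI1, rule nz | rule disjI2, rule nz)+)
      simp
  have 6: "(e - 1) / norm2 (- 8 / 5) (e - 1) + (e - b2) / norm2 (- b1) (e - b2) + 1 / 2 = 0"
    by (rule interior_min_deriv_zero[OF _ lt(6), of "\<lambda>t. net_length b1 b2 c d1 d2 t"], rule min,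
        (assumption | rule mem)+, unfold net_length_def,
        (rule derivative_eq_intros norm2_deriv refl nz | rule disjI1, rule nz | rule disjI2, rule nz)+)
      simp
  show ?thesis by (rule that[OF mem 1 2 3 4 5 6])
qed

section \<open>The net of a critical point\<close>

text \<open>Five is the largest size for which passing to the complement works: six vectors could
  split into two balanced triples.\<close>

lemma sum_unit_vectors_indecomposable:
  fixes f :: "'a \<Rightarrow> 'b::real_normed_vector"
  assumes N: "finite N" "card N \<le> 5" "sum f N = 0"
    and nz: "\<And>u. u \<in> N \<Longrightarrow> f u \<noteq> 0" "\<And>u w. \<lbrakk>u \<in> N; w
        \<in> N; u \<noteq> w\<rbrakk> \<Longrightarrow> f u + f w \<noteq> 0"
    and T: "T \<subseteq> N" "T \<noteq> {}" "sum f T = 0"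
  shows "T = N"
proof (rule ccontr)
  assume "T \<noteq> N"
  have fin: "finite T" using N(1) T(1) finite_subset by blast
  have small: False if U: "U \<subseteq> N" "U \<noteq> {}" "sum f U = 0" "card U \<le> 2" for U
  proof -
    have "finite U" using U(1) N(1) finite_subset by blast
    then have "card U = 1 \<or> card U = 2" using U(2,4) card_0_eq[of U] by linarith
    then show False
    proof
      assume "card U = 1"
      then obtain u where "U = {u}" by (auto simp: card_1_singleton_iff)
      then show False using nz(1)[of u] U by simp
    next
      assume "card U = 2"
      then obtain u w where "U = {u, w}" "u \<noteq> w" by (auto simp: card_2_iff)
      then show False using nz(2)[of u w] U by simp
    qed
  qed
  have "card T + card (N - T) = card N"
    using N(1) T(1) by (metis card_Diff_subset card_mono fin le_add_diff_inverse)
  moreover have "sum f (N - T) = 0" using N T by (simp add: sum_diff)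
  moreover have "N - T \<noteq> {}" using T(1) \<open>T \<noteq> N\<close> by blast
  moreover have "card T \<le> 2 \<or> card (N - T) \<le> 2" using calculation(1) N(2) by linarith
  ultimately show False using small[of T] small[of "N - T"] T by blast
qed

lemma product_perturbation:
  fixes a b e :: real
  assumes "\<bar>a' - a\<bar> \<le> e" "\<bar>b' - b\<bar> \<le> e"
  shows "\<bar>a' * b' - a * b\<bar> \<le> e * (\<bar>a\<bar> + \<bar>b\<bar>) + e\<^sup>2"
proof -
  have "a' * b' - a * b = a * (b' - b) + (a' - a) * b + (a' - a) * (b' - b)"
    by (simp add: algebra_simps)
  then have "\<bar>a' * b' - a * b\<bar> \<le> \<bar>a\<bar> * \<bar>b' - b\<bar> + \<bar>a' -
      a\<bar> * \<bar>b\<bar> + \<bar>a' - a\<bar> * \<bar>b' - b\<bar>"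
    by (metis (no_types, opaque_lifting) abs_mult abs_triangle_ineq add_right_mono order_trans)
  also have "\<dots> \<le> \<bar>a\<bar> * e + e * \<bar>b\<bar> + e * e"
    using assms by (intro add_mono mult_mono) auto
  finally show ?thesis by (simp add: power2_eq_square algebra_simps)
qed

lemma mem_segs:
  "(Corner s t, Inner s t) \<in> set segs" "(Corner (\<not> s) t, Inner s t) \<in> set segs"
  "(Corner s t, Horiz s) \<in> set segs" "(Inner s t, Horiz s) \<in> set segs"
  "(Corner s t, Outer s t) \<in> set segs" "(Corner s (\<not> t), Outer s t) \<in> set segs"
  "(Inner s t, Outer s t) \<in> set segs" "(Corner s t, Vertical t) \<in> set segs"
  "(Inner s t, Vertical t) \<in> set segs" "(Horiz True, Horiz False) \<in> set segs"
  "(Vertical True, Vertical False) \<in> set segs"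
  by (cases s; cases t; simp add: segs_def)+

lemma set_adjacent_iff: "m \<in> set (adjacent n) \<longleftrightarrow> (n, m) \<in> set segs \<or>
    (m, n) \<in> set segs"
  by (auto simp: adjacent_def image_iff)

lemma set_adjacent:
  "set (adjacent (Inner s t)) = {Corner s t, Corner (\<not> s) t, Horiz s, Outer s t, Vertical t}"
  "set (adjacent (Outer s t)) = {Corner s t, Corner s (\<not> t), Inner s t}"
  "set (adjacent (Horiz s)) = {Corner s True, Corner s False, Inner s True, Inner s False, Horiz
      (\<not> s)}"
  "set (adjacent (Vertical t)) = {Corner True t, Corner False t, Inner True t, Inner False t,
      Vertical (\<not> t)}"
  "set (adjacent (Corner s t)) =
     {Inner s t, Inner (\<not> s) t, Horiz s, Outer s t, Outer s (\<not> t), Vertical t}"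
  by (cases s; cases t; auto simp: adjacent_def segs_def)+

text \<open>Connectedness of the graph of hubs without the corners, in the form of an invariance
  principle. It serves twice: to spread a set of segments through the hubs alone, and to connect the
  arrangement.\<close>

lemma constant_along_segs:
  assumes "\<And>i j. \<lbrakk>(i, j) \<in> set segs; i \<in> set hubs; j \<in> set hubs\<rbrakk>
      \<Longrightarrow> F i = F j" and "n \<in> set hubs"
  shows "F n = F (Horiz True)"
proof -
  have h: "Horiz s \<in> set hubs" "Vertical t \<in> set hubs" "Inner s t \<in> set hubs" "Outer s t
      \<in> set hubs" for s t
    by (cases s; cases t; simp add: hubs_def)+
  have H: "F (Horiz s) = F (Horiz True)" for s
    using assms(1)[OF mem_segs(10) h(1) h(1)] by (cases s) simp_all
  have I: "F (Inner s t) = F (Horiz True)" for s t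
    using assms(1)[OF mem_segs(4) h(3) h(1)] H by simp
  have "F (Vertical t) = F (Horiz True)" for t
    using assms(1)[OF mem_segs(9) h(3) h(2)] I by metis
  moreover have "F (Outer s t) = F (Horiz True)" for s t
    using assms(1)[OF mem_segs(7) h(3) h(4)] I by metis
  ultimately show ?thesis using H I assms(2) by (cases n) (auto simp: hubs_def)
qed

lemma hub_iff: "n \<in> set hubs \<longleftrightarrow> (\<forall>s t. n \<noteq> Corner s t)"
  by (cases n) (auto simp: hubs_def)

lemma seg_has_hub: "(i, j) \<in> set segs \<Longrightarrow> j \<in> set hubs"
  by (auto simp: segs_def hub_iff)

definition point :: "real \<Rightarrow> real \<Rightarrow> real ^ 2" where "point x y = vector [x, y]"

lemma point_simps [simp]:
  "point x y $ 1 = x" "point x y $ 2 = y"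
  "point x y = point x' y' \<longleftrightarrow> x = x' \<and> y = y'"
  "point x y - point x' y' = point (x - x') (y - y')"
  "point x y + point x' y' = point (x + x') (y + y')"
  "point 0 0 = 0"
  by (simp_all add: point_def vec_eq_iff forall_2)

text \<open>The signs drop out of the norm, so one set of equations balances all mirror images at
  once.\<close>

lemma sgn_point: "sgn (point (sg s * x) (sg t * y)) = point (sg s * (x / norm2 x y)) (sg t *
    (y / norm2 x y))"
proof -
  have "norm (point (sg s * x) (sg t * y)) = norm2 x y"
    by (cases s; cases t; simp add: norm_vec_def L2_set_def UNIV_2 norm2_def sg_def)
  then show ?thesis
    by (simp add: sgn_div_norm vec_eq_iff forall_2 divide_inverse)
qed

section \<open>Positions of the nodes and signs of their orientations\<close>

locale net_solution =
  fixes b1 b2 c d1 d2 e :: real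
  assumes near: "\<bar>b1 - 625979 / 1000000\<bar> \<le> 1 / 10000" "\<bar>b2 - 11829 / 100000\<bar>
      \<le> 1 / 10000"
    "\<bar>c - 648773 / 1000000\<bar> \<le> 1 / 10000" "\<bar>d1 - 1027054 / 1000000\<bar> \<le>
        1 / 10000"
    "\<bar>d2 - 100758 / 1000000\<bar> \<le> 1 / 10000" "\<bar>e - 109677 / 1000000\<bar> \<le>
        1 / 10000"
  and inner_x:
    "(b1 - 8 / 5) / norm2 (b1 - 8 / 5) (b2 - 1) + (b1 + 8 / 5) / norm2 (b1 + 8 / 5) (b2 - 1)
      + (b1 - c) / norm2 (c - b1) (- b2) + (b1 - d1) / norm2 (b1 - d1) (b2 - d2)
      + b1 / norm2 (- b1) (e - b2) = 0"
  and inner_y: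
    "(b2 - 1) / norm2 (b1 - 8 / 5) (b2 - 1) + (b2 - 1) / norm2 (b1 + 8 / 5) (b2 - 1)
      + b2 / norm2 (c - b1) (- b2) + (b2 - d2) / norm2 (b1 - d1) (b2 - d2)
      + (b2 - e) / norm2 (- b1) (e - b2) = 0"
  and horiz: "(c - 8 / 5) / norm2 (c - 8 / 5) (- 1) + (c - b1) / norm2 (c - b1) (- b2) + 1 / 2 = 0"
  and outer_x:
    "(d1 - 8 / 5) / norm2 (d1 - 8 / 5) (d2 - 1) + (d1 - 8 / 5) / norm2 (d1 - 8 / 5) (d2 + 1)
      + (d1 - b1) / norm2 (b1 - d1) (b2 - d2) = 0"
  and outer_y:
    "(d2 - 1) / norm2 (d1 - 8 / 5) (d2 - 1) + (d2 + 1) / norm2 (d1 - 8 / 5) (d2 + 1)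
      + (d2 - b2) / norm2 (b1 - d1) (b2 - d2) = 0"
  and vertical: "(e - 1) / norm2 (- 8 / 5) (e - 1) + (e - b2) / norm2 (- b1) (e - b2) + 1 / 2 = 0"
begin

primrec pos :: "node \<Rightarrow> real ^ 2" where
  "pos (Corner s t) = point (sg s * (8 / 5)) (sg t * 1)"
| "pos (Inner s t) = point (sg s * b1) (sg t * b2)"
| "pos (Outer s t) = point (sg s * d1) (sg t * d2)"
| "pos (Horiz s) = point (sg s * c) 0"
| "pos (Vertical t) = point 0 (sg t * e)"

text \<open>The radius 1/10000 of the cube is 100 units of 10^(-6), exactly the tolerance built into
  \<open>side\<close>.\<close>

lemma pos_near:
  "\<bar>1000000 * pos n $ 1 - of_int (fst (approx n))\<bar> \<le> 100"
  "\<bar>1000000 * pos n $ 2 - of_int (snd (approx n))\<bar> \<le> 100"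
  using near unfolding abs_le_iff by (cases n; auto simp: sg_def field_simps)+

text \<open>Nodes with equal positions would have approximations within 200 of each other in both
  coordinates, which happens for no two nodes.\<close>

lemma inj_pos: "inj pos"
proof (rule injI, rule ccontr)
  fix m n assume eq: "pos m = pos n" and ne: "m \<noteq> n"
  have "\<bar>real_of_int (fst (approx m) - fst (approx n))\<bar> \<le> 200"
    "\<bar>real_of_int (snd (approx m) - snd (approx n))\<bar> \<le> 200"
    using pos_near[of m] pos_near[of n] unfolding eq by (simp_all add: abs_le_iff)
  then have "\<bar>fst (approx m) - fst (approx n)\<bar> \<le> 200" "\<bar>snd (approx m) - snd
      (approx n)\<bar> \<le> 200"
    by linarith+
  then show False using ne by (cases m; cases n) (auto simp: sg_def split: if_splits)
qed

text \<open>Coordinates are off by at most 100 and their differences by at most 200, so each of the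
  two products is off by at most 200 times the sum of its absolute factors plus 40000. Together this
  is \<open>err\<close>, and an integer determinant exceeding it has the true sign.\<close>

lemma side_orient:
  assumes "side i j k \<noteq> 0"
  shows "0 < of_int (side i j k) * orient (pos i) (pos j) (pos k)"
proof -
  define X where "X n = 1000000 * pos n $ 1" for n
  define Y where "Y n = 1000000 * pos n $ 2" for n
  define x where "x n = real_of_int (fst (approx n))" for n
  define y where "y n = real_of_int (snd (approx n))" for n
  have XY: "\<bar>X n - x n\<bar> \<le> 100" "\<bar>Y n - y n\<bar> \<le> 100" for n
    using pos_near[of n] by (simp_all add: X_def Y_def x_def y_def)
  have d: "\<bar>(X m - X n) - (x m - x n)\<bar> \<le> 200" "\<bar>(Y m - Y n) - (y m - y n)\<bar>
      \<le> 200" for m n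
    using XY(1)[of m] XY(1)[of n] XY(2)[of m] XY(2)[of n] by linarith+
  define m where "m = (x j - x i) * (y k - y i) - (y j - y i) * (x k - x i)"
  define err where "err = 200 * (\<bar>x j - x i\<bar> + \<bar>y k - y i\<bar> + \<bar>y j - y
      i\<bar> + \<bar>x k - x i\<bar>) + 80000"
  have O: "1000000000000 * orient (pos i) (pos j) (pos k)
      = (X j - X i) * (Y k - Y i) - (Y j - Y i) * (X k - X i)"
    by (simp add: orient_def X_def Y_def algebra_simps)
  have "\<bar>1000000000000 * orient (pos i) (pos j) (pos k) - m\<bar> \<le> err"
    using product_perturbation[OF d(1)[of j i] d(2)[of k i]] product_perturbation[OF d(2)[of j i]
        d(1)[of k i]]
    unfolding O m_def err_def by (simp add: abs_le_iff)
  moreover have "side i j k = (if err < m then 1 else if m < - err then - 1 else 0)"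
  proof -
    obtain ix iy jx jy kx ky where *: "approx i = (ix, iy)" "approx j = (jx, jy)" "approx k = (kx, ky)"
      by (metis surj_pair)
    have "m = of_int ((jx - ix) * (ky - iy) - (jy - iy) * (kx - ix))"
      "err = of_int (200 * (\<bar>jx - ix\<bar> + \<bar>ky - iy\<bar> + \<bar>jy - iy\<bar> +
          \<bar>kx - ix\<bar>) + 80000)"
      by (simp_all add: m_def err_def x_def y_def *)
    then show ?thesis unfolding side_def * by (simp only: Let_def prod.case of_int_less_iff
        of_int_minus[symmetric])
  qed
  ultimately show ?thesis using assms by (auto split: if_splits)
qed

lemma side_nonzero: "side i j k \<noteq> 0 \<Longrightarrow> orient (pos i) (pos j) (pos k) \<noteq> 0"
  using side_orient[of i j k] by auto

lemma side_values: "side i j k \<in> {- 1, 0, 1}"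
  by (auto simp: side_def Let_def split: prod.splits)

lemma side_products:
  "side i j k * side i j l = 1 \<Longrightarrow> 0 < orient (pos i) (pos j) (pos k) * orient (pos i)
      (pos j) (pos l)"
  "side i j k * side i j l = - 1 \<Longrightarrow> orient (pos i) (pos j) (pos k) * orient (pos i)
      (pos j) (pos l) < 0"
  using side_orient[of i j k] side_orient[of i j l] side_values[of i j k] side_values[of i j l]
  by (auto simp: mult_less_0_iff zero_less_mult_iff)

section \<open>Incidences of the segments\<close>

definition seg :: "node \<times> node \<Rightarrow> (real ^ 2) set" where "seg p = {pos (fst p), pos
    (snd p)}"

definition S :: "(real ^ 2) set set" where "S = seg ` set segs"

definition B :: "(real ^ 2) set" where "B = pos ` range (\<lambda>(s, t). Corner s t)"

lemma crossing_sym: "crossing p q \<longleftrightarrow> crossing q p"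
  by (auto simp: crossing_def split: prod.splits)

lemma crossing_unique:
  assumes "crossing p q" "x \<in> convex hull seg p" "x \<in> convex hull seg q"
    "y \<in> convex hull seg p" "y \<in> convex hull seg q"
  shows "x = y"
  using assms orient_crossing_unique[OF side_products(2)]
  by (auto simp: crossing_def seg_def segment_convex_hull[symmetric] split: prod.splits)

lemma crossing_interior:
  assumes "crossing p q" "x \<in> convex hull seg p" "x \<in> convex hull seg q"
  shows "x \<notin> seg p" "x \<notin> seg q"
proof -
  obtain i j k l where "p = (i, j)" "q = (k, l)" by (metis surj_pair)
  then have "x \<notin> {pos i, pos j, pos k, pos l}" and [simp]: "p = (i, j)" "q = (k, l)"
    using assms orient_crossing_interior[OF side_products(2)[of i j k l] side_products(2)[of k l i j]]
    by (simp_all add: crossing_def seg_def segment_convex_hull[symmetric])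
  then show "x \<notin> seg p" "x \<notin> seg q" by (auto simp: seg_def)
qed

lemma crossing_exists:
  assumes "crossing p q"
  obtains x where "x \<in> convex hull seg p" "x \<in> convex hull seg q"
proof -
  obtain i j k l where "p = (i, j)" "q = (k, l)" by (metis surj_pair)
  then show ?thesis
    using that assms orient_crossing_exists[OF side_products(2)[of i j k l] side_products(2)[of k l i j]]
    by (auto simp: crossing_def seg_def segment_convex_hull[symmetric])
qed

lemma placed_meet:
  assumes "placed p q" "x \<in> convex hull seg p" "x \<in> convex hull seg q"
  shows "x \<in> seg p \<inter> seg q \<or> crossing p q"
proof -
  obtain i j k l where pq: "p = (i, j)" "q = (k, l)" by (metis surj_pair)
  have x: "x \<in> closed_segment (pos i) (pos j)" "x \<in> closed_segment (pos j) (pos i)"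
    "x \<in> closed_segment (pos k) (pos l)" "x \<in> closed_segment (pos l) (pos k)"
    using assms(2,3) pq by (simp_all add: seg_def segment_convex_hull[symmetric] closed_segment_commute)
  have share: "x = pos n" if "side n m o' \<noteq> 0" "x \<in> closed_segment (pos n) (pos m)"
    "x \<in> closed_segment (pos n) (pos o')" for n m o'
    using orient_common_end[OF side_nonzero] that by blast
  consider "i = k" "side i j l \<noteq> 0" | "j = l" "side j i k \<noteq> 0" | "i = l" "side i j k
      \<noteq> 0"
    | "j = k" "side j i l \<noteq> 0" | "apart p q" | "crossing p q"
    using assms(1) pq by (auto simp: placed_def split: if_splits)
  then show ?thesis
  proof cases
    case 1 then show ?thesis using share x pq by (auto simp: seg_def)
  next
    case 2 then show ?thesis using share x pq by (auto simp: seg_def)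
  next
    case 3 then show ?thesis using share x pq by (auto simp: seg_def)
  next
    case 4 then show ?thesis using share x pq by (auto simp: seg_def)
  next
    case 5
    then have "side i j k * side i j l = 1 \<or> side k l i * side k l j = 1"
      using pq by (simp add: apart_def)
    then show ?thesis
      using orient_same_side[OF side_products(1)] x by blast
  qed simp
qed

lemma segs_meet:
  assumes "p \<in> set segs" "q \<in> set segs" "p \<noteq> q" "x \<in> convex hull seg p" "x \<in>
      convex hull seg q"
  shows "x \<in> seg p \<inter> seg q \<or> crossing p q"
proof -
  have "placed p q \<or> placed q p"
    using pairs_cover[OF assms(1-3)] placed_segs by (auto simp: list_all_iff)
  then show ?thesis using placed_meet[of p q x] placed_meet[of q p x] assms(4,5) crossing_sym by blast
qed

lemma seg_eq_iff:
  assumes "p \<in> set segs" "q \<in> set segs"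
  shows "seg p = seg q \<longleftrightarrow> p = q"
proof -
  obtain i j k l where pq: "p = (i, j)" "q = (k, l)" by (metis surj_pair)
  have "(j, i) \<notin> set segs" using segs_proper(1) assms(1) pq by (auto simp: list_all_iff)
  then have "\<not> (i = l \<and> j = k)" using assms(2) pq by auto
  then show ?thesis using pq inj_pos by (auto simp: seg_def doubleton_eq_iff inj_eq)
qed

lemma range_pos: "\<Union>S = range pos"
proof
  show "\<Union>S \<subseteq> range pos" by (auto simp: S_def seg_def)
  have "\<exists>m. (n, m) \<in> set segs \<or> (m, n) \<in> set segs" for n
    using mem_segs by (cases n) blast+
  then show "range pos \<subseteq> \<Union>S" by (force simp: S_def seg_def)
qed

lemma B_eq: "pos n \<in> B \<longleftrightarrow> n \<notin> set hubs"
  unfolding B_def inj_image_mem_iff[OF inj_pos] hub_iff by auto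

section \<open>Balance at hubs and corners\<close>

lemma neighbours_pos: "{w. {pos n, w} \<in> S} = pos ` set (adjacent n)"
proof (intro equalityI subsetI)
  fix w assume "w \<in> {w. {pos n, w} \<in> S}"
  then obtain i j where "(i, j) \<in> set segs" "{pos n, w} = {pos i, pos j}"
    by (auto simp: S_def seg_def)
  then show "w \<in> pos ` set (adjacent n)"
    using inj_pos by (auto simp: set_adjacent_iff doubleton_eq_iff inj_eq)
next
  fix w assume "w \<in> pos ` set (adjacent n)"
  then show "w \<in> {w. {pos n, w} \<in> S}"
    by (force simp: set_adjacent_iff S_def seg_def insert_commute)
qed

lemma sum_neighbours:
  assumes "N \<subseteq> set (adjacent n)"
  shows "(\<Sum>w\<in>pos ` N. sgn (w - pos n)) = (\<Sum>m\<in>N. sgn (pos m - pos n))"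
  using inj_on_subset[OF inj_pos, of N] by (simp add: sum.reindex)

lemma card_adjacent: "n \<in> set hubs \<Longrightarrow> card (set (adjacent n)) = 3 \<or> card (set
    (adjacent n)) = 5"
  by (cases n) (auto simp: hub_iff set_adjacent)

text \<open>The norm is passed as \<open>k\<close> so that it can be written as in the equations of
  the critical point; linear arithmetic then sees the same terms on both sides, whatever the
  direction of the edge.\<close>

lemma sgn_pos_diffI:
  assumes "pos m - pos n = point (sg s * x) (sg t * y)" "norm2 x y = k"
  shows "sgn (pos m - pos n) = point (sg s * (x / k)) (sg t * (y / k))"
  unfolding assms(1) sgn_point assms(2) ..

lemma sgn_pos_diff:
  "sgn (pos (Corner s t) - pos (Inner s t))
     = point (sg s * ((8 / 5 - b1) / norm2 (b1 - 8 / 5) (b2 - 1))) (sg t * ((1 - b2) / norm2 (b1 -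
         8 / 5) (b2 - 1)))"
  "sgn (pos (Corner (\<not> s) t) - pos (Inner s t))
     = point (sg s * (- (b1 + 8 / 5) / norm2 (b1 + 8 / 5) (b2 - 1))) (sg t * ((1 - b2) / norm2 (b1 +
         8 / 5) (b2 - 1)))"
  "sgn (pos (Horiz s) - pos (Inner s t))
     = point (sg s * ((c - b1) / norm2 (c - b1) (- b2))) (sg t * (- b2 / norm2 (c - b1) (- b2)))"
  "sgn (pos (Outer s t) - pos (Inner s t))
     = point (sg s * ((d1 - b1) / norm2 (b1 - d1) (b2 - d2))) (sg t * ((d2 - b2) / norm2 (b1 - d1)
         (b2 - d2)))"
  "sgn (pos (Vertical t) - pos (Inner s t))
     = point (sg s * (- b1 / norm2 (- b1) (e - b2))) (sg t * ((e - b2) / norm2 (- b1) (e - b2)))"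
  "sgn (pos (Corner s t) - pos (Outer s t))
     = point (sg s * ((8 / 5 - d1) / norm2 (d1 - 8 / 5) (d2 - 1))) (sg t * ((1 - d2) / norm2 (d1 -
         8 / 5) (d2 - 1)))"
  "sgn (pos (Corner s (\<not> t)) - pos (Outer s t))
     = point (sg s * ((8 / 5 - d1) / norm2 (d1 - 8 / 5) (d2 + 1))) (sg t * (- (d2 + 1) / norm2 (d1 -
         8 / 5) (d2 + 1)))"
  "sgn (pos (Corner s t) - pos (Horiz s))
     = point (sg s * ((8 / 5 - c) / norm2 (c - 8 / 5) (- 1))) (sg t * (1 / norm2 (c - 8 / 5) (- 1)))"
  "sgn (pos (Corner s t) - pos (Vertical t))
     = point (sg s * (8 / 5 / norm2 (- 8 / 5) (e - 1))) (sg t * ((1 - e) / norm2 (- 8 / 5) (e - 1)))"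
  "sgn (pos (Inner s t) - pos (Horiz s))
     = point (sg s * ((b1 - c) / norm2 (c - b1) (- b2))) (sg t * (b2 / norm2 (c - b1) (- b2)))"
  "sgn (pos (Inner s t) - pos (Outer s t))
     = point (sg s * ((b1 - d1) / norm2 (b1 - d1) (b2 - d2))) (sg t * ((b2 - d2) / norm2 (b1 - d1)
         (b2 - d2)))"
  "sgn (pos (Inner s t) - pos (Vertical t))
     = point (sg s * (b1 / norm2 (- b1) (e - b2))) (sg t * ((b2 - e) / norm2 (- b1) (e - b2)))"
  by (rule sgn_pos_diffI; cases s; cases t; simp add: sg_def norm2_def power2_eq_square algebra_simps)+

lemma ranges: "0 < b1" "b1 < 8 / 5" "0 < c" "c < 8 / 5" "0 < d1" "d1 < 8 / 5" "0 < e"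
  using near unfolding abs_le_iff by linarith+

lemma sgn_pos_diff_axis:
  "sgn (pos (Horiz (\<not> s)) - pos (Horiz s)) = point (sg s * - 1) 0"
  "sgn (pos (Vertical (\<not> t)) - pos (Vertical t)) = point 0 (sg t * - 1)"
proof -
  note pos = ranges(3,7)
  have "sgn (pos (Horiz (\<not> s)) - pos (Horiz s)) = point (sg s * (- 2 * c / (2 * c))) (sg True *
      (0 / (2 * c)))"
    by (rule sgn_pos_diffI) (use pos in \<open>auto simp: sg_def norm2_def power_mult_distrib
        real_sqrt_mult\<close>)
  then show "sgn (pos (Horiz (\<not> s)) - pos (Horiz s)) = point (sg s * - 1) 0" using pos by simp
  have "sgn (pos (Vertical (\<not> t)) - pos (Vertical t)) = point (sg True * (0 / (2 * e))) (sg t *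
      (- 2 * e / (2 * e)))"
    by (rule sgn_pos_diffI) (use pos in \<open>auto simp: sg_def norm2_def power_mult_distrib
        real_sqrt_mult\<close>)
  then show "sgn (pos (Vertical (\<not> t)) - pos (Vertical t)) = point 0 (sg t * - 1)" using pos by simp
qed

lemma balanced_hub:
  assumes "n \<in> set hubs"
  shows "(\<Sum>m\<in>set (adjacent n). sgn (pos m - pos n)) = 0"
proof -
  note div = diff_divide_distrib add_divide_distrib minus_divide_left[symmetric]
  have zero: "point (sg s * x) (sg t * y) = 0" if "x = 0" "y = 0" for s t x y using that by simp
  have zero_x: "point (sg s * x) y = 0" if "x = 0" "y = 0" for s x y using that by simp
  have zero_y: "point x (sg t * y) = 0" if "x = 0" "y = 0" for t x y using that by simp
  show ?thesis
  proof (cases n)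
    case (Inner s t)
    have "(\<Sum>m\<in>set (adjacent n). sgn (pos m - pos n)) =
      sgn (pos (Corner s t) - pos n) + (sgn (pos (Corner (\<not> s) t) - pos n) + (sgn (pos (Horiz
          s) - pos n)
        + (sgn (pos (Outer s t) - pos n) + sgn (pos (Vertical t) - pos n))))"
      unfolding Inner set_adjacent by (simp del: pos.simps)
    \<comment> \<open>Up to sign, the two components are the partial derivatives in
      \<open>b1\<close> and \<open>b2\<close>, once the signs of the quadrant are taken out.\<close>
    also have "\<dots> = 0"
      unfolding Inner sgn_pos_diff point_simps(5) distrib_left[symmetric]
      by (rule zero; unfold div; use inner_x[unfolded div] inner_y[unfolded div] in linarith)
    finally show ?thesis .
  next
    case (Outer s t)
    have "(\<Sum>m\<in>set (adjacent n). sgn (pos m - pos n)) =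
      sgn (pos (Corner s t) - pos n) + (sgn (pos (Corner s (\<not> t)) - pos n) + sgn (pos (Inner s
          t) - pos n))"
      unfolding Outer set_adjacent by (simp del: pos.simps)
    also have "\<dots> = 0"
      unfolding Outer sgn_pos_diff point_simps(5) distrib_left[symmetric]
      by (rule zero; unfold div; use outer_x[unfolded div] outer_y[unfolded div] in linarith)
    finally show ?thesis .
  next
    case (Horiz s)
    have "(\<Sum>m\<in>set (adjacent n). sgn (pos m - pos n)) =
      sgn (pos (Corner s True) - pos n) + (sgn (pos (Corner s False) - pos n) + (sgn (pos (Inner s
          True) - pos n)
        + (sgn (pos (Inner s False) - pos n) + sgn (pos (Horiz (\<not> s)) - pos n))))"
      unfolding Horiz set_adjacent by (simp del: pos.simps)
    \<comment> \<open>The vertical components cancel by reflection, and the horizontal ones add up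
      to -2 times the equation for \<open>c\<close>.\<close>
    also have "\<dots> = 0"
      unfolding Horiz sgn_pos_diff sgn_pos_diff_axis point_simps(5) distrib_left[symmetric]
      by (rule zero_x, unfold div, use horiz[unfolded div] in linarith, simp add: sg_def)
    finally show ?thesis .
  next
    case (Vertical t)
    have "(\<Sum>m\<in>set (adjacent n). sgn (pos m - pos n)) =
      sgn (pos (Corner True t) - pos n) + (sgn (pos (Corner False t) - pos n) + (sgn (pos (Inner
          True t) - pos n)
        + (sgn (pos (Inner False t) - pos n) + sgn (pos (Vertical (\<not> t)) - pos n))))"
      unfolding Vertical set_adjacent by (simp del: pos.simps)
    also have "\<dots> = 0"
      unfolding Vertical sgn_pos_diff sgn_pos_diff_axis point_simps(5) distrib_left[symmetric]
      by (rule zero_y, simp add: sg_def, unfold div, use vertical[unfolded div] in linarith)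
    finally show ?thesis .
  next
    case (Corner s t)
    then show ?thesis using assms hub_iff by blast
  qed
qed

lemma indecomposable_hub:
  assumes "n \<in> set hubs" "T \<subseteq> set (adjacent n)" "T \<noteq> {}" "(\<Sum>m\<in>T. sgn
      (pos m - pos n)) = 0"
  shows "T = set (adjacent n)"
proof (rule sum_unit_vectors_indecomposable[where f = "\<lambda>m. sgn (pos m - pos n)"])
  show "card (set (adjacent n)) \<le> 5" using card_adjacent[OF assms(1)] by auto
  show "sgn (pos m - pos n) \<noteq> 0" if "m \<in> set (adjacent n)" for m
  proof -
    have "m \<noteq> n" using that segs_proper(1) by (auto simp: set_adjacent_iff list_all_iff)
    then show ?thesis using inj_pos by (simp add: sgn_zero_iff inj_eq del: pos.simps)
  qed
  show "sgn (pos u - pos n) + sgn (pos w - pos n) \<noteq> 0"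
    if "u \<in> set (adjacent n)" "w \<in> set (adjacent n)" "u \<noteq> w" for u w
  proof -
    have *: "sgn (pos j - pos n) + sgn (pos k - pos n) \<noteq> 0" if "(j, k) \<in> set (pairs
        (adjacent n))" for j k
    proof -
      have "side n j k \<noteq> 0" using that hubs_no_opposite assms(1) by (fastforce simp: list_all_iff)
      then show ?thesis by (intro orient_opposite side_nonzero)
    qed
    show ?thesis using pairs_cover[OF that] *[of u w] *[of w u] by (auto simp: add.commute)
  qed
qed (use assms balanced_hub in simp_all)

text \<open>All segments at a corner lead strictly inwards in the first coordinate, so these
  components cannot cancel.\<close>

lemma unbalanced_corner:
  assumes "n \<notin> set hubs"
  shows "(\<Sum>m\<in>set (adjacent n). sgn (pos m - pos n)) \<noteq> 0"
proof
  assume 0: "(\<Sum>m\<in>set (adjacent n). sgn (pos m - pos n)) = 0"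
  obtain s t where n: "n = Corner s t" using assms by (auto simp: hub_iff)
  have neg: "sg s * sgn (pos m - pos n) $ 1 < 0" if m: "m \<in> set (adjacent n)" for m
  proof -
    have lt: "sg s * (pos m - pos n) $ 1 < 0"
      using m ranges unfolding n set_adjacent by (cases s; auto simp: sg_def)
    then have "pos m - pos n \<noteq> 0" by auto
    then have "0 < inverse (norm (pos m - pos n))" by simp
    then have "inverse (norm (pos m - pos n)) * (sg s * (pos m - pos n) $ 1) < 0"
      using lt by (rule mult_pos_neg)
    then show ?thesis by (simp add: sgn_div_norm mult.left_commute del: pos.simps)
  qed
  have "0 < (\<Sum>m\<in>set (adjacent n). - (sg s * sgn (pos m - pos n) $ 1))"
    by (rule sum_pos) (use neg n in \<open>auto simp: set_adjacent\<close>)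
  also have "\<dots> = - (sg s * (\<Sum>m\<in>set (adjacent n). sgn (pos m - pos n)) $ 1)"
    by (simp add: sum_distrib_left sum_negf del: pos.simps)
  finally show False using 0 by simp
qed

text \<open>An end of another segment lying on this one would be a common end or a proper crossing,
  and the latter avoids all ends of both.\<close>

lemma seg_end_on_seg:
  assumes "p \<in> set segs" "x \<in> convex hull seg p" "x \<in> \<Union>S"
  shows "x \<in> seg p"
proof -
  obtain q where q: "q \<in> set segs" "x \<in> seg q" using assms(3) by (auto simp: S_def)
  show ?thesis
  proof (cases "q = p")
    case False
    have xq: "x \<in> convex hull seg q" using q(2) by (simp add: hull_inc)
    then show ?thesis
      using segs_meet[OF q(1) assms(1) False xq assms(2)] crossing_interior[OF _ xq assms(2)] q(2)
          by blast
  qed (use q in simp)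
qed

lemma crossing_cover:
  assumes "p \<in> set segs" "q \<in> set segs" "p \<noteq> q" "crossing p q"
  shows "(p, q) \<in> set crossing_pairs \<or> (q, p) \<in> set crossing_pairs"
  using pairs_cover[OF assms(1-3)] assms(4) crossing_sym by (auto simp: crossing_pairs_def)

lemma crossing_pairsD:
  assumes "(p, q) \<in> set crossing_pairs"
  shows "p \<in> set segs" "q \<in> set segs" "p \<noteq> q" "crossing p q" "(q, p) \<notin> set
      crossing_pairs"
  using assms pairs_members[of p q segs] pairs_distinct[OF segs_proper(2)]
  by (auto simp: crossing_pairs_def)

lemma concurrent_segs:
  assumes segs: "p \<in> set segs" "q \<in> set segs" "r \<in> set segs"
    and x: "x \<in> convex hull seg p" "x \<in> convex hull seg q" "x \<in> convex hull seg r" "x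
        \<notin> \<Union>S"
  shows "p = q \<or> p = r \<or> q = r"
proof (rule ccontr)
  assume "\<not> ?thesis"
  then have ne: "p \<noteq> q" "p \<noteq> r" "q \<noteq> r" by auto
  have "x \<notin> seg p" "x \<notin> seg q" using x(4) segs by (auto simp: S_def)
  then have c: "crossing p q" "crossing p r" "crossing q r"
    using segs_meet[OF segs(1,2) ne(1) x(1,2)] segs_meet[OF segs(1,3) ne(2) x(1,3)]
      segs_meet[OF segs(2,3) ne(3) x(2,3)] by blast+
  have free: "\<not> (crossing p r \<and> crossing q r)" if "(p, q) \<in> set crossing_pairs" for p q
    using crossing_pairs_triangle_free that segs(3) by (fastforce simp: list_all_iff)
  show False using crossing_cover[OF segs(1,2) ne(1) c(1)] free[of p q] free[of q p] c by blast
qed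

section \<open>The arrangement satisfies the hypotheses on segments\<close>

sublocale N: segment_net S B
proof
  show "finite S" by (simp add: S_def)
  show "S \<noteq> {}" by (simp add: S_def segs_def)
  show "B \<subseteq> \<Union>S" unfolding range_pos B_def by blast
  fix s assume "s \<in> S"
  then obtain i j where "(i, j) \<in> set segs" "s = {pos i, pos j}" by (auto simp: S_def seg_def)
  moreover then have "pos i \<noteq> pos j"
    using segs_proper(1) inj_pos by (auto simp: list_all_iff inj_eq)
  ultimately show "card s = 2" by simp
next
  fix s t x assume *: "s \<in> S" "t \<in> S" "s \<noteq> t" "x \<in> convex hull s" "x \<in> convex
      hull t" "x \<in> \<Union>S"
  then show "x \<in> s \<inter> t" using seg_end_on_seg by (auto simp: S_def)
next
  fix s t x y assume *: "s \<in> S" "t \<in> S" "s \<noteq> t" "x \<in> convex hull s" "x \<in>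
      convex hull t"
    "y \<in> convex hull s" "y \<in> convex hull t"
  then obtain p q where pq: "p \<in> set segs" "q \<in> set segs" "s = seg p" "t = seg q" "p \<noteq> q"
    by (auto simp: S_def)
  show "x = y"
  proof (cases "crossing p q")
    case True
    then show ?thesis using crossing_unique * pq by blast
  next
    case False
    then have "x \<in> seg p \<inter> seg q" "y \<in> seg p \<inter> seg q" using segs_meet[OF
        pq(1,2,5)] * pq by blast+
    then show ?thesis using *(3) pq by (auto simp: seg_def)
  qed
next
  fix s t r x assume "s \<in> S" "t \<in> S" "r \<in> S" "x \<in> convex hull s" "x \<in> convex
      hull t" "x \<in> convex hull r"
    "x \<notin> \<Union>S"
  then show "s = t \<or> s = r \<or> t = r" using concurrent_segs unfolding S_def by blast
next
  fix T assume T: "T \<subseteq> S" "T \<noteq> {}"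
    and closed: "\<And>v s t. \<lbrakk>v \<in> \<Union>S - B; s \<in> S; t \<in> T; v \<in> s; v
        \<in> t\<rbrakk> \<Longrightarrow> s \<in> T"
  \<comment> \<open>At a hub this holds as soon as one of the segments there belongs to
    \<open>T\<close>, by \<open>closed\<close>. Hence \<open>F\<close> takes the same value at both
    ends of a segment between hubs.\<close>
  define F where "F n \<longleftrightarrow> (\<forall>p\<in>set segs. pos n \<in> seg p
      \<longrightarrow> seg p \<in> T)" for n
  have full: "F n" if "n \<in> set hubs" "seg p \<in> T" "pos n \<in> seg p" for n p
    unfolding F_def
  proof (intro ballI impI)
    fix q assume "q \<in> set segs" "pos n \<in> seg q"
    then show "seg q \<in> T"
      using closed[of "pos n" "seg q" "seg p"] that B_eq[of n] range_pos by (auto simp: S_def)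
  qed
  have const: "F n = F (Horiz True)" if "n \<in> set hubs" for n
  proof (rule constant_along_segs[OF _ that])
    fix i j assume ij: "(i, j) \<in> set segs" "i \<in> set hubs" "j \<in> set hubs"
    have "pos i \<in> seg (i, j)" "pos j \<in> seg (i, j)" by (simp_all add: seg_def)
    then show "F i = F j" using full[of _ "(i, j)"] ij unfolding F_def by blast
  qed
  obtain t where "t \<in> T" using T(2) by blast
  moreover then have "t \<in> seg ` set segs" using T(1) by (auto simp: S_def)
  ultimately obtain i j where "(i, j) \<in> set segs" "seg (i, j) \<in> T" by auto
  then have "F (Horiz True)"
    using full[of j "(i, j)"] seg_has_hub const by (auto simp: seg_def)
  have "seg (i, j) \<in> T" if "(i, j) \<in> set segs" for i j
  proof -
    have "F j" using const seg_has_hub[OF that] \<open>F (Horiz True)\<close> by blast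
    then show ?thesis using that by (auto simp: F_def seg_def)
  qed
  then have "S \<subseteq> T" by (auto simp: S_def)
  then show "T = S" using T by blast
next
  fix u v assume "u \<in> \<Union>S" "v \<in> \<Union>S"
  then obtain m n where mn: "u = pos m" "v = pos n" unfolding range_pos by blast
  let ?R = "{(x, y). {x, y} \<in> S}"
  have sym: "sym (?R\<^sup>*)" by (intro sym_rtrancl) (simp add: sym_def insert_commute)
  define F where "F n \<longleftrightarrow> (pos (Horiz True), pos n) \<in> ?R\<^sup>*" for n
  have step: "F i = F j" if "(i, j) \<in> set segs" for i j
  proof -
    have "{pos i, pos j} \<in> S" using that by (force simp: S_def seg_def)
    then have "(pos i, pos j) \<in> ?R" "(pos j, pos i) \<in> ?R" by (simp_all add: insert_commute)
    then show ?thesis unfolding F_def by (blast intro: rtrancl_into_rtrancl)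
  qed
  have hub: "F k" if "k \<in> set hubs" for k
  proof -
    have "F k = F (Horiz True)" using that step by (intro constant_along_segs)
    then show ?thesis by (simp add: F_def)
  qed
  \<comment> \<open>A corner is reached through the segment to the inner hub of its
    quadrant.\<close>
  have all: "F k" for k
  proof (cases "k \<in> set hubs")
    case False
    then obtain s t where "k = Corner s t" by (auto simp: hub_iff)
    then show ?thesis using step[OF mem_segs(1)] hub[of "Inner s t"] by (simp add: hub_iff)
  qed (rule hub)
  have "(pos m, pos (Horiz True)) \<in> ?R\<^sup>*" using all[of m] symD[OF sym] by (simp add: F_def)
  then show "(u, v) \<in> ?R\<^sup>*" using all[of n] unfolding mn F_def by (rule rtrancl_trans)
next
  fix v assume "v \<in> \<Union>S - B"
  then obtain n where n: "v = pos n" "n \<in> set hubs" using range_pos B_eq by auto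
  show "(\<Sum>w\<in>{w. {v, w} \<in> S}. sgn (w - v)) = 0"
    unfolding n neighbours_pos sum_neighbours[OF subset_refl] by (rule balanced_hub[OF n(2)])
  show "card {w. {v, w} \<in> S} \<noteq> 2"
    unfolding n neighbours_pos card_image[OF inj_on_subset[OF inj_pos subset_UNIV]]
    using card_adjacent[OF n(2)] by auto
  fix N assume N: "N \<subseteq> {w. {v, w} \<in> S}" "N \<noteq> {}" "(\<Sum>w\<in>N. sgn (w - v)) = 0"
  then obtain T where T: "N = pos ` T" "T \<subseteq> set (adjacent n)"
    unfolding n neighbours_pos subset_image_iff by blast
  then have "T = set (adjacent n)"
    using indecomposable_hub[OF n(2) T(2)] N sum_neighbours[OF T(2)] n(1) by simp
  then show "N = {w. {v, w} \<in> S}" unfolding n neighbours_pos T by simp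
next
  fix v assume "v \<in> B"
  then obtain n where n: "v = pos n" "n \<notin> set hubs" using B_eq by (auto simp: B_def)
  show "(\<Sum>w\<in>{w. {v, w} \<in> S}. sgn (w - v)) \<noteq> 0"
    unfolding n neighbours_pos sum_neighbours[OF subset_refl] by (rule unbalanced_corner[OF n(2)])
qed

section \<open>Counting the vertices\<close>

lemma card_crossings: "card N.crossings = 13"
proof -
  have "\<forall>p\<in>set crossing_pairs. \<exists>x. x \<in> convex hull seg (fst p) \<and> x
      \<in> convex hull seg (snd p)"
    using crossing_exists crossing_pairsD(4) by (metis prod.collapse)
  then obtain f where f: "\<And>p q. (p, q) \<in> set crossing_pairs \<Longrightarrow>
      f (p, q) \<in> convex hull seg p \<and> f (p, q) \<in> convex hull seg q"
    by (metis fst_conv snd_conv)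
  have outside: "f (p, q) \<notin> \<Union>S" if pq: "(p, q) \<in> set crossing_pairs" for p q
    using seg_end_on_seg crossing_interior(1)[OF crossing_pairsD(4)[OF pq]] crossing_pairsD(1)[OF
        pq] f[OF pq]
    by blast
  have "bij_betw f (set crossing_pairs) N.crossings"
    unfolding bij_betw_def
  proof
    show "inj_on f (set crossing_pairs)"
    proof (rule inj_onI, clarify)
      fix p q r s assume pq: "(p, q) \<in> set crossing_pairs" and rs: "(r, s) \<in> set crossing_pairs"
        and eq: "f (p, q) = f (r, s)"
      note D = crossing_pairsD[OF pq] crossing_pairsD[OF rs]
      have h: "f (p, q) \<in> convex hull seg p" "f (p, q) \<in> convex hull seg q" "f (p, q) \<in>
          convex hull seg r"
        "f (p, q) \<in> convex hull seg s" using f[OF pq] f[OF rs] eq by simp_all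
      \<comment> \<open>Only \<open>p\<close> and \<open>q\<close> pass through the point, so the
        second pair consists of the same two segments; and the list has them in one order
        only.\<close>
      have "r = p \<or> r = q" using concurrent_segs[OF D(1,2,6) h(1,2,3) outside[OF pq]] D(3) by blast
      moreover have "s = p \<or> s = q" using concurrent_segs[OF D(1,2,7) h(1,2,4) outside[OF pq]]
          D(3) by blast
      ultimately show "p = r \<and> q = s" using D(5,8) rs by blast
    qed
    show "f ` set crossing_pairs = N.crossings"
    proof (intro equalityI subsetI)
      fix x assume "x \<in> f ` set crossing_pairs"
      then obtain p q where pq: "(p, q) \<in> set crossing_pairs" "x = f (p, q)" by auto
      note D = crossing_pairsD[OF pq(1)]
      have "seg p \<in> S" "seg q \<in> S" "seg p \<noteq> seg q" using D seg_eq_iff by (auto simp: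
          S_def)
      then show "x \<in> N.crossings"
        using f[OF pq(1)] outside[OF pq(1)] unfolding pq(2) N.crossings_def by blast
    next
      fix x assume "x \<in> N.crossings"
      then obtain p q where x: "x \<notin> \<Union>S" "p \<in> set segs" "q \<in> set segs" "p
          \<noteq> q"
        "x \<in> convex hull seg p" "x \<in> convex hull seg q"
        unfolding N.crossings_def by (auto simp: S_def)
      have "x \<notin> seg p" using x(1,2) by (auto simp: S_def)
      then have c: "crossing p q" using segs_meet[OF x(2-6)] by blast
      have "x = f (p', q')" if "(p', q') \<in> set crossing_pairs" "{p', q'} = {p, q}" for p' q'
        using crossing_unique[OF crossing_pairsD(4)[OF that(1)], of x "f (p', q')"] f[OF that(1)] x
            that(2)
        by (auto simp: doubleton_eq_iff)
      then show "x \<in> f ` set crossing_pairs"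
        using crossing_cover[OF x(2,3,4) c] by blast
    qed
  qed
  then have "card N.crossings = card (set crossing_pairs)" by (simp add: bij_betw_same_card)
  also have "\<dots> = 13"
  proof -
    have "distinct crossing_pairs"
      using pairs_distinct(1)[OF segs_proper(2)] by (simp add: crossing_pairs_def)
    then show ?thesis using length_crossing_pairs by (simp add: distinct_card)
  qed
  finally show ?thesis .
qed

lemma card_hubs_corners: "card (\<Union>S - B) = 12" "card B = 4"
proof -
  have "\<Union>S - B = pos ` set hubs" unfolding range_pos using B_eq by auto
  then have "card (\<Union>S - B) = card (set hubs)"
    using card_image[OF inj_on_subset[OF inj_pos subset_UNIV]] by simp
  then show "card (\<Union>S - B) = 12" by (simp add: hubs_def)
  have "range (\<lambda>(s, t). Corner s t) = {Corner True True, Corner True False, Corner False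
      True, Corner False False}"
    by (auto simp: image_iff)
  then have "card (range (\<lambda>(s, t). Corner s t)) = 4" by simp
  then show "card B = 4"
    unfolding B_def card_image[OF inj_on_subset[OF inj_pos subset_UNIV]] .
qed

lemma net_exists:
  "\<exists>G. geodesic_net G \<and> no_degree_two G \<and> irreducible_net G \<and>
    card (bdry G) = 4 \<and> card (balanced_verts G) = 25"
  using N.geodesic_net_net N.no_degree_two_net N.irreducible_net_net N.card_balanced_verts
    card_crossings card_hubs_corners by (intro exI[of _ N.net]) simp
end

theorem mainTheorem1:
  shows "\<exists>G. geodesic_net G \<and> no_degree_two G \<and> irreducible_net G \<and>
    card (bdry G) = 4 \<and> card (balanced_verts G) = 25"
proof -
  obtain b1 b2 c d1 d2 e :: real where "net_solution b1 b2 c d1 d2 e"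
  proof (rule critical_point)
    fix b1 b2 c d1 d2 e :: real
    assume "\<bar>b1 - 625979 / 1000000\<bar> \<le> 1 / 10000" "\<bar>b2 - 11829 / 100000\<bar>
        \<le> 1 / 10000"
      "\<bar>c - 648773 / 1000000\<bar> \<le> 1 / 10000" "\<bar>d1 - 1027054 / 1000000\<bar> \<le>
          1 / 10000"
      "\<bar>d2 - 100758 / 1000000\<bar> \<le> 1 / 10000" "\<bar>e - 109677 / 1000000\<bar> \<le>
          1 / 10000"
      "(b1 - 8 / 5) / norm2 (b1 - 8 / 5) (b2 - 1) + (b1 + 8 / 5) / norm2 (b1 + 8 / 5) (b2 - 1)
      + (b1 - c) / norm2 (c - b1) (- b2) + (b1 - d1) / norm2 (b1 - d1) (b2 - d2)
      + b1 / norm2 (- b1) (e - b2) = 0"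
    "(b2 - 1) / norm2 (b1 - 8 / 5) (b2 - 1) + (b2 - 1) / norm2 (b1 + 8 / 5) (b2 - 1)
      + b2 / norm2 (c - b1) (- b2) + (b2 - d2) / norm2 (b1 - d1) (b2 - d2)
      + (b2 - e) / norm2 (- b1) (e - b2) = 0"
    "(c - 8 / 5) / norm2 (c - 8 / 5) (- 1) + (c - b1) / norm2 (c - b1) (- b2) + 1 / 2 = 0"
    "(d1 - 8 / 5) / norm2 (d1 - 8 / 5) (d2 - 1) + (d1 - 8 / 5) / norm2 (d1 - 8 / 5) (d2 + 1)
      + (d1 - b1) / norm2 (b1 - d1) (b2 - d2) = 0"
    "(d2 - 1) / norm2 (d1 - 8 / 5) (d2 - 1) + (d2 + 1) / norm2 (d1 - 8 / 5) (d2 + 1)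
      + (d2 - b2) / norm2 (b1 - d1) (b2 - d2) = 0"
    "(e - 1) / norm2 (- 8 / 5) (e - 1) + (e - b2) / norm2 (- b1) (e - b2) + 1 / 2 = 0"
    then have "net_solution b1 b2 c d1 d2 e" by unfold_locales
    then show thesis by (rule that)
  qed
  then show ?thesis by (rule net_solution.net_exists)
qed

end
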